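(* Let $r_-\approx0.4364590141$ be the root of $69r^4+14r^2-76r+28$ in $(0.43,0.44)$ and let $r_*\approx0.4486234903$ be the root of $44-160r+196r^2-178r^3+198r^4-199r^5$ in $(0.44,0.45)$. Let $r_-\le r\le r_*$ and let $n\ge2$ be an integer not of the form $2^{\ell}$ for any positive integer $\ell$. Then both $\delta_n(I)$ and $\alpha_n(I)$ form CVTs with $n$-means for $P$, and moreover $$V(P,\delta_n(I))<V(P,\alpha_n(I)),$$ where $V(P,\cdot)$ denotes the distortion error (for arbitrary admissible index sets $I$ and arbitrary choices of the sets $A_\sigma$, $C_\sigma$).
   Context: Let $0<r<\frac12$, $S_1(x)=rx$, $S_2(x)=rx+(1-r)$ on $\mathbb R$; $P$ is the unique Borel probability measure on $\mathbb R$ with $P=\frac12P\circ S_1^{-1}+\frac12P\circ S_2^{-1}$. For a word $\sigma=\sigma_1\cdots\sigma_k\in\{1,2\}^k$ put $S_\sigma=S_{\sigma_1}\circ\cdots\circ S_{\sigma_k}$ and $J_\sigma=S_\sigma([0,1])$; $\emptyset$ is the empty word ($S_\emptyset=\mathrm{id}$, $\{1,2\}^0=\{\emptyset\}$), and $\sigma\tau$ denotes concatenation. For words $\beta,\dots,\delta$, $a(\beta,\dots,\delta)=\frac{1}{P(J_\beta\cup\cdots\cup J_\delta)}\int_{J_\beta\cup\cdots\cup J_\delta}x\,dP(x)$. The distortion error of a finite set $\alpha\subset\mathbb R$ is $V(P,\alpha)=\int\min_{a\in\alpha}(x-a)^2\,dP(x)$. For each word $\sigma$, $A_\sigma$ denotes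 one of the two sets $\{a(\sigma11,\sigma121,\sigma1221),\ a(\sigma1222,\sigma21),\ a(\sigma22)\}$ or $\{a(\sigma11),\ a(\sigma12,\sigma2111),\ a(\sigma2112,\sigma212,\sigma22)\}$, and $C_\sigma$ denotes one of the two sets $\{a(\sigma11,\sigma1211,\sigma12121),\ a(\sigma12122,\sigma122,\sigma211),\ a(\sigma212,\sigma22)\}$ or $\{a(\sigma11,\sigma121),\ a(\sigma122,\sigma211,\sigma21211),\ a(\sigma21212,\sigma2122,\sigma22)\}$ (chosen arbitrarily and independently for each $\sigma$). Definition of $\alpha_n(I)$ and $\delta_n(I)$ for $n\geq 2$ not a power of $2$. Let $\ell=\ell(n)$ be the integer with $2^{\ell}<n<2^{\ell+1}$. (1) If $n=2^{\ell}+k$ with $1\le k\le2^{\ell-1}$, then $I\subseteq\{1,2\}^{\ell-1}$ with $\mathrm{card}(I)=k$ and $\alpha_n(I)=\bigcup_{\sigma\in I}A_\sigma\cup\{S_{\sigma1}(\frac12),S_{\sigma2}(\frac12):\sigma\in\{1,2\}^{\ell-1}\setminus I\}$ (so $\alpha_n(I)=\bigcup_{\sigma\in I}A_\sigma$ if $k=2^{\ell-1}$, and $\alpha_3(I)=A_\emptyset$). (2) If $n=3\cdot2^{\ell-1}+k$ with $1\le k\le2^{\ell-1}-1$, then $I\subseteq\{1,2\}^{\ell-1}$ with $\mathrm{card}(I)=k$ and $\alpha_n(I)=\bigcup_{\sigma\in\{1,2\}^{\ell-1}\setminus I}A_\sigma\cup\{S_{\sigma\tau}(\frac12):\sigma\in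 I,\ \tau\in\{1,2\}^2\}$. In both cases $\delta_n(I)$ is defined by the same formula with every $A_\sigma$ replaced by $C_\sigma$. For a finite set $\alpha\subset\mathbb R$, the Voronoi region of $a\in\alpha$ is $M(a|\alpha)=\{x\in\mathbb R:|x-a|=\min_{b\in\alpha}|x-b|\}$. A set $\alpha$ of $n$ points forms a centroidal Voronoi tessellation (CVT) with $n$-means (for $P$) if for every $a\in\alpha$ we have $P(M(a|\alpha))>0$ and $a=\frac{1}{P(M(a|\alpha))}\int_{M(a|\alpha)}x\,dP(x)$. *)

theory Defs
  imports "HOL-Probability.Probability"
begin

type_synonym word = "nat list"

(* Words over {1, 2}; digits other than 1 and 2 never occur in a word. *)
definition words :: "nat \<Rightarrow> word set" where
  "words k = {\<sigma>. length \<sigma> = k \<and> set \<sigma> \<subseteq> {1, 2}}"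

definition S :: "real \<Rightarrow> nat \<Rightarrow> real \<Rightarrow> real" where
  "S r i x = (if i = 1 then r * x else r * x + (1 - r))"

fun S_word :: "real \<Rightarrow> word \<Rightarrow> real \<Rightarrow> real" where
  "S_word r [] = id"
| "S_word r (i # \<sigma>) = S r i \<circ> S_word r \<sigma>"

definition J :: "real \<Rightarrow> word \<Rightarrow> real set" where
  "J r \<sigma> = S_word r \<sigma> ` {0..1}"

(* For 0 < r < 1/2 exactly one measure P satisfies this predicate. *)
definition self_similar_measure :: "real \<Rightarrow> real measure \<Rightarrow> bool" where
  "self_similar_measure r P \<longleftrightarrow>
     prob_space P \<and> sets P = sets borel \<and>
     (\<forall>B \<in> sets borel.
        measure P B = 1/2 * measure P (S r 1 -` B) + 1/2 * measure P (S r 2 -` B))"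

definition centroid :: "real measure \<Rightarrow> real set \<Rightarrow> real" where
  "centroid P B = (1 / measure P B) * (LINT x:B|P. x)"

definition a :: "real \<Rightarrow> real measure \<Rightarrow> word list \<Rightarrow> real" where
  "a r P ws = centroid P (\<Union>\<sigma> \<in> set ws. J r \<sigma>)"

definition distortion :: "real measure \<Rightarrow> real set \<Rightarrow> real" where
  "distortion P \<alpha> = (LINT x|P. Min ((\<lambda>b. (x - b)\<^sup>2) ` \<alpha>))"

definition voronoi :: "real \<Rightarrow> real set \<Rightarrow> real set" where
  "voronoi b \<alpha> = {x. \<bar>x - b\<bar> = Min ((\<lambda>c. \<bar>x - c\<bar>) ` \<alpha>)}"

definition is_CVT :: "real measure \<Rightarrow> nat \<Rightarrow> real set \<Rightarrow> bool" where
  "is_CVT P n \<alpha> \<longleftrightarrow>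
     finite \<alpha> \<and> card \<alpha> = n \<and>
     (\<forall>b \<in> \<alpha>. measure P (voronoi b \<alpha>) > 0 \<and> b = centroid P (voronoi b \<alpha>))"

definition A_sets :: "real \<Rightarrow> real measure \<Rightarrow> word \<Rightarrow> real set set" where
  "A_sets r P \<sigma> =
     {{a r P [\<sigma> @ [1,1], \<sigma> @ [1,2,1], \<sigma> @ [1,2,2,1]],
       a r P [\<sigma> @ [1,2,2,2], \<sigma> @ [2,1]],
       a r P [\<sigma> @ [2,2]]},
      {a r P [\<sigma> @ [1,1]],
       a r P [\<sigma> @ [1,2], \<sigma> @ [2,1,1,1]],
       a r P [\<sigma> @ [2,1,1,2], \<sigma> @ [2,1,2], \<sigma> @ [2,2]]}}"

definition C_sets :: "real \<Rightarrow> real measure \<Rightarrow> word \<Rightarrow> real set set" where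
  "C_sets r P \<sigma> =
     {{a r P [\<sigma> @ [1,1], \<sigma> @ [1,2,1,1], \<sigma> @ [1,2,1,2,1]],
       a r P [\<sigma> @ [1,2,1,2,2], \<sigma> @ [1,2,2], \<sigma> @ [2,1,1]],
       a r P [\<sigma> @ [2,1,2], \<sigma> @ [2,2]]},
      {a r P [\<sigma> @ [1,1], \<sigma> @ [1,2,1]],
       a r P [\<sigma> @ [1,2,2], \<sigma> @ [2,1,1], \<sigma> @ [2,1,2,1,1]],
       a r P [\<sigma> @ [2,1,2,1,2], \<sigma> @ [2,1,2,2], \<sigma> @ [2,2]]}}"

definition ell :: "nat \<Rightarrow> nat" where
  "ell n = (THE l. 2 ^ l < n \<and> n < 2 ^ (l + 1))"

(* If n >= 2 is not a power of 2 then ell n >= 1, and no subtraction below truncates.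
   The case split n <= 3 * 2^(l-1) is that of n = 2^l + k with 1 <= k <= 2^(l-1) against
   n = 3 * 2^(l-1) + k with 1 <= k <= 2^(l-1) - 1. *)
definition admissible :: "nat \<Rightarrow> word set \<Rightarrow> bool" where
  "admissible n I \<longleftrightarrow>
     (let l = ell n in
        I \<subseteq> words (l - 1) \<and>
        card I = (if n \<le> 3 * 2 ^ (l - 1) then n - 2 ^ l else n - 3 * 2 ^ (l - 1)))"

(* codebook r A n I is alpha_n(I) and codebook r C n I is delta_n(I), where A and C give
   the chosen three-point sets A_sigma and C_sigma. *)
definition codebook :: "real \<Rightarrow> (word \<Rightarrow> real set) \<Rightarrow> nat \<Rightarrow> word set \<Rightarrow> real set" where
  "codebook r B n I =
     (let l = ell n in
        if n \<le> 3 * 2 ^ (l - 1)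
        then (\<Union>\<sigma> \<in> I. B \<sigma>) \<union>
             (\<Union>\<sigma> \<in> words (l - 1) - I. {S_word r (\<sigma> @ [1]) (1/2), S_word r (\<sigma> @ [2]) (1/2)})
        else (\<Union>\<sigma> \<in> words (l - 1) - I. B \<sigma>) \<union>
             {S_word r (\<sigma> @ \<tau>) (1/2) | \<sigma> \<tau>. \<sigma> \<in> I \<and> \<tau> \<in> words 2})"

end

theory Submission
  imports Defs
begin

text \<open>
  The measure \<open>P\<close> lives on a Cantor set in the unit interval and consists of two
  copies of itself, scaled by \<open>r\<close> and carrying half of the mass each. This reduces
  the theorem from \<open>n\<close> points to three.

  \<^emph>\<open>Gluing.\<close> Let two codebooks in the unit interval be tessellations, each
  with points close to both ends of the interval. Place scaled copies in the two halves. A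
  location in one half then finds its nearest point in the same half, because the gap between
  the halves is wide. So the Voronoi regions are the scaled old ones
  (\<open>voronoi_glue_same\<close>, \<open>voronoi_glue_other\<close>), the union is again a
  tessellation, and its distortion is \<open>r\<^sup>2 / 2\<close> times the sum of the two
  distortions (\<open>is_CVT_glue\<close>, \<open>distortion_glue\<close>). Repeating this, one
  may put an arbitrary choice of such codebooks into the \<open>2 ^ m\<close> blocks of level
  \<open>m\<close> (\<open>glueable_glue_words\<close>, \<open>distortion_glue_words\<close>).
  The codebooks of the theorem arise in this way from the three-point sets of the empty word and
  from the symmetric sets with two or four points.

  \<^emph>\<open>Three points.\<close> Three consecutive groups of cells are the Voronoi regions
  of their centroids when the midpoints of neighbouring centroids fall into the gaps between the
  groups (\<open>three_cluster_CVT\<close>). For each of the four sets this is a list of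
  polynomial inequalities in \<open>r\<close>. The only tight ones are \<open>69 * r ^ 4 + 14 *
  r ^ 2 - 76 * r + 28 \<le> 0\<close> for the sets \<open>A\<close>, which holds from
  \<open>r_minus\<close> on, and the one for the sets \<open>C\<close>, which holds up to
  \<open>r_star\<close>. At the extreme ratios a midpoint touches a cell; this is harmless
  because \<open>P\<close> has no atoms.

  \<^emph>\<open>Distortion.\<close> The distortion of a tessellation is the second moment of
  \<open>P\<close> minus the sum of mass times squared point (\<open>distortion_of_CVT\<close>).
  The two codebooks coincide outside the blocks with three points, of which there is at least
  one. In such a block the sums for \<open>C\<close> and \<open>A\<close> differ by \<open>(1 -
  r)\<^sup>2 / 110880\<close> times a polynomial that is positive in the relevant range
  (\<open>quality_less\<close>).
\<close>

section \<open>The self-similar measure and its integrals\<close>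

locale cantor_measure =
  fixes r :: real and P :: "real measure"
  assumes r_pos: "0 < r" and r_half: "r < 1/2"
    and self_similar: "self_similar_measure r P"
begin

sublocale prob_space P
  using self_similar by (simp add: self_similar_measure_def)

lemma sets_P [measurable_cong, simp]: "sets P = sets borel"
  using self_similar by (simp add: self_similar_measure_def)

lemma space_P [simp]: "space P = UNIV"
  using sets_eq_imp_space_eq[OF sets_P] by simp

lemma measurable_S [measurable]: "S r i \<in> borel_measurable borel"
  unfolding S_def by (cases "i = 1") auto

lemma vimage_S_borel: "B \<in> sets borel \<Longrightarrow> S r i -` B \<in> sets borel"
  using measurable_sets[OF measurable_S, of B i] by simp

lemma prob_split:
  "B \<in> sets borel \<Longrightarrow> prob B = 1/2 * prob (S r 1 -` B) + 1/2 * prob (S r 2 -` B)"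
  using self_similar by (simp add: self_similar_measure_def)

text \<open>
  The defining identity for measures of sets passes to integrals by building the integrand up
  from indicators. Multiplying by 2 keeps fractions out of the arithmetic of
  \<^typ>\<open>ennreal\<close>.
\<close>

lemma nn_integral_split:
  fixes f :: "real \<Rightarrow> ennreal"
  assumes "f \<in> borel_measurable borel"
  shows "2 * (\<integral>\<^sup>+x. f x \<partial>P) = (\<integral>\<^sup>+x. f (S r 1 x) \<partial>P) + (\<integral>\<^sup>+x. f (S r 2 x) \<partial>P)"
  using assms
proof (induction rule: borel_measurable_induct)
  case (cong f g)
  then show ?case by simp
next
  case (set B)
  have ind: "indicator B (S r i x) = indicator (S r i -` B) x" for i x
    by (simp add: indicator_def)
  have "2 * emeasure P B = ennreal (2 * prob B)"
    by (simp add: emeasure_eq_measure ennreal_mult)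
  also have "\<dots> = ennreal (prob (S r 1 -` B) + prob (S r 2 -` B))"
    using prob_split[OF set] by simp
  also have "\<dots> = emeasure P (S r 1 -` B) + emeasure P (S r 2 -` B)"
    by (simp add: emeasure_eq_measure)
  finally show ?case
    using set by (simp add: ind vimage_S_borel)
next
  case (mult u c)
  have [measurable]: "u \<in> borel_measurable borel" by fact
  show ?case
    by (simp add: nn_integral_cmult mult.left_commute[of 2] mult.IH distrib_left)
next
  case (add u v)
  have [measurable]: "u \<in> borel_measurable borel" "v \<in> borel_measurable borel" by fact+
  show ?case
    by (simp add: nn_integral_add add.IH distrib_left add.assoc add.left_commute)
next
  case (seq U)
  have [measurable]: "\<And>i. U i \<in> borel_measurable borel" by fact
  have inc: "incseq (\<lambda>i x. U i (S r j x))" for j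
    using seq(3) by (auto simp: incseq_def le_fun_def)
  have sup: "(SUP i. U i) x = (SUP i. U i x)" for x by (simp add: image_comp)
  have "2 * (\<integral>\<^sup>+x. (SUP i. U i x) \<partial>P) = (SUP i. 2 * (\<integral>\<^sup>+x. U i x \<partial>P))"
    by (subst nn_integral_monotone_convergence_SUP)
       (use seq(3) in \<open>auto simp: SUP_mult_left_ennreal\<close>)
  also have "\<dots> = (SUP i. (\<integral>\<^sup>+x. U i (S r 1 x) \<partial>P) + (\<integral>\<^sup>+x. U i (S r 2 x) \<partial>P))"
    by (simp add: seq.IH)
  also have "\<dots> = (SUP i. \<integral>\<^sup>+x. U i (S r 1 x) \<partial>P) + (SUP i. \<integral>\<^sup>+x. U i (S r 2 x) \<partial>P)"
    by (rule ennreal_SUP_add)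
       (use inc in \<open>auto simp: incseq_def le_fun_def intro!: nn_integral_mono\<close>)
  also have "\<dots> = (\<integral>\<^sup>+x. (SUP i. U i (S r 1 x)) \<partial>P) + (\<integral>\<^sup>+x. (SUP i. U i (S r 2 x)) \<partial>P)"
    by (simp add: nn_integral_monotone_convergence_SUP inc)
  finally show ?case by (simp only: sup)
qed

lemma
  fixes f :: "real \<Rightarrow> real"
  assumes f: "integrable P f"
  shows integrable_comp_S: "i \<in> {1,2} \<Longrightarrow> integrable P (\<lambda>x. f (S r i x))"
    and expectation_split: "(LINT x|P. f x) =
      1/2 * (LINT x|P. f (S r 1 x)) + 1/2 * (LINT x|P. f (S r 2 x))"
proof -
  have [measurable]: "f \<in> borel_measurable borel"
    using borel_measurable_integrable[OF f] by simp
  have int: "integrable P (\<lambda>x. f (S r i x))" if i: "i \<in> {1,2}" for i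
  proof (rule integrableI_bounded)
    show "(\<lambda>x. f (S r i x)) \<in> borel_measurable P" by measurable
    have "2 * (\<integral>\<^sup>+x. norm (f x) \<partial>P) < \<infinity>"
      using f by (simp add: integrable_iff_bounded ennreal_mult_less_top)
    then have "(\<integral>\<^sup>+x. norm (f (S r 1 x)) \<partial>P) + (\<integral>\<^sup>+x. norm (f (S r 2 x)) \<partial>P) < \<infinity>"
      by (subst (asm) nn_integral_split) auto
    then show "(\<integral>\<^sup>+x. norm (f (S r i x)) \<partial>P) < \<infinity>"
      using i by auto
  qed
  then show "i \<in> {1,2} \<Longrightarrow> integrable P (\<lambda>x. f (S r i x))" .
  have enn: "2 * enn2real (\<integral>\<^sup>+x. g x \<partial>P) =
      enn2real (\<integral>\<^sup>+x. g (S r 1 x) \<partial>P) + enn2real (\<integral>\<^sup>+x. g (S r 2 x) \<partial>P)"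
    if [measurable]: "g \<in> borel_measurable borel" and fin: "(\<integral>\<^sup>+x. g x \<partial>P) < \<infinity>"
    for g :: "real \<Rightarrow> ennreal"
  proof -
    have "2 * (\<integral>\<^sup>+x. g x \<partial>P) < \<infinity>" using fin by (simp add: ennreal_mult_less_top)
    then have "(\<integral>\<^sup>+x. g (S r 1 x) \<partial>P) < top" "(\<integral>\<^sup>+x. g (S r 2 x) \<partial>P) < top"
      by (subst (asm) nn_integral_split, simp, simp)+
    then have "enn2real (2 * (\<integral>\<^sup>+x. g x \<partial>P)) =
        enn2real (\<integral>\<^sup>+x. g (S r 1 x) \<partial>P) + enn2real (\<integral>\<^sup>+x. g (S r 2 x) \<partial>P)"
      by (subst nn_integral_split) (auto simp: enn2real_plus)
    then show ?thesis by (simp add: enn2real_mult)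
  qed
  have "integrable P (\<lambda>x. - f x)" using f by simp
  then have fin: "(\<integral>\<^sup>+x. ennreal (f x) \<partial>P) < \<infinity>" "(\<integral>\<^sup>+x. ennreal (- f x) \<partial>P) < \<infinity>"
    using f by (auto simp: real_integrable_def less_top)
  show "(LINT x|P. f x) = 1/2 * (LINT x|P. f (S r 1 x)) + 1/2 * (LINT x|P. f (S r 2 x))"
    using enn[OF _ fin(1)] enn[OF _ fin(2)]
    by (simp add: real_lebesgue_integral_def f int algebra_simps)
qed

lemma prob_UNIV [simp]: "prob UNIV = 1"
  using prob_space by simp

lemma S_simps: "S r 1 x = r * x" "S r (Suc 0) x = r * x" "S r 2 x = r * x + (1 - r)"
  by (simp_all add: S_def)

lemma S_mem_unit:
  assumes "x \<in> {0..1}"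
  shows "S r i x \<in> {0..1}"
proof -
  have "0 \<le> r * x" "r * x \<le> r"
    using assms r_pos mult_left_mono[of x 1 r] by auto
  then show ?thesis using r_half by (auto simp: S_def)
qed

text \<open>
  A map \<^term>\<open>S r i\<close> multiplies the excess of \<open>\<bar>x - 1/2\<bar>\<close>
  over \<open>1/2\<close> by at most \<open>r\<close>. So the mass at excess more than
  \<open>s\<close> is at most the mass at excess more than \<open>s / r\<close>, and, iterating,
  at most the mass outside any given ball around \<open>1/2\<close>.
\<close>

lemma AE_unit_interval: "AE x in P. x \<in> {0..1}"
proof -
  define G where "G s = prob {x. 1/2 + s < \<bar>x - 1/2\<bar>}" for s
  have meas: "{x. s < \<bar>x - 1/2\<bar>} \<in> sets borel" for s :: real by measurable
  have expand: "G s \<le> G (s / r)" if "s > 0" for s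
  proof -
    have "prob (S r i -` {x. 1/2 + s < \<bar>x - 1/2\<bar>}) \<le> G (s / r)" if "i \<in> {1,2}" for i
      unfolding G_def
    proof (rule finite_measure_mono)
      show "S r i -` {x. 1/2 + s < \<bar>x - 1/2\<bar>} \<subseteq> {x. 1/2 + s / r < \<bar>x - 1/2\<bar>}"
      proof
        fix x assume "x \<in> S r i -` {x. 1/2 + s < \<bar>x - 1/2\<bar>}"
        then have 1: "1/2 + s < \<bar>S r i x - 1/2\<bar>" by simp
        define e where "e = (if i = 1 then - 1 else 1) * ((1 - r) / 2)"
        have "S r i x - 1/2 = r * (x - 1/2) + e"
          using that by (auto simp: S_def e_def field_simps)
        moreover have "\<bar>e\<bar> = (1 - r) / 2"
          using r_half by (simp add: e_def)
        ultimately have "\<bar>S r i x - 1/2\<bar> \<le> \<bar>r * (x - 1/2)\<bar> + (1 - r) / 2"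
          using abs_triangle_ineq[of "r * (x - 1/2)" e] by linarith
        then have "1/2 + s < r * \<bar>x - 1/2\<bar> + (1 - r) / 2"
          using 1 r_pos by (simp add: abs_mult)
        then have "r / 2 + s < r * \<bar>x - 1/2\<bar>" by (simp add: field_simps)
        then show "x \<in> {x. 1/2 + s / r < \<bar>x - 1/2\<bar>}"
          using r_pos by (simp add: field_simps)
      qed
    qed (use meas in auto)
    from this[of 1] this[of 2] show ?thesis
      unfolding G_def[of s] using prob_split[OF meas[of "1/2 + s"]] by simp
  qed
  have pow: "G s \<le> G (s * (1 / r) ^ n)" if "s > 0" for s n
  proof (induction n)
    case (Suc n)
    show ?case
      using Suc expand[of "s * (1 / r) ^ n"] that r_pos by (simp add: field_simps)
  qed simp
  have zero: "G s = 0" if s: "s > 0" for s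
  proof -
    have "(\<lambda>n. prob {x. real n < \<bar>x - 1/2\<bar>}) \<longlonglongrightarrow> prob (\<Inter>n. {x. real n < \<bar>x - 1/2\<bar>})"
      by (rule finite_Lim_measure_decseq) (use meas in \<open>auto simp: decseq_def\<close>)
    moreover have "(\<Inter>n. {x. real n < \<bar>x - 1/2\<bar>}) = {}"
    proof -
      have "\<exists>n. \<not> real n < \<bar>x - 1/2\<bar>" for x :: real
        using reals_Archimedean2[of "\<bar>x - 1/2\<bar>"] less_asym by blast
      then show ?thesis by blast
    qed
    ultimately have lim: "(\<lambda>n. prob {x. real n < \<bar>x - 1/2\<bar>}) \<longlonglongrightarrow> 0" by simp
    have "G s \<le> prob {x. real n < \<bar>x - 1/2\<bar>}" for n
    proof -
      obtain k where "real n / s < (1 / r) ^ k"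
        using real_arch_pow[of "1 / r"] r_pos r_half by auto
      then have k: "real n < s * (1 / r) ^ k" using s by (simp add: field_simps)
      have "G s \<le> G (s * (1 / r) ^ k)" using pow s by blast
      also have "\<dots> \<le> prob {x. real n < \<bar>x - 1/2\<bar>}"
        unfolding G_def by (rule finite_measure_mono) (use k meas in auto)
      finally show ?thesis .
    qed
    then have "G s \<le> 0" using LIMSEQ_le_const[OF lim] by blast
    then show ?thesis by (simp add: G_def measure_le_0_iff)
  qed
  have "AE x in P. \<forall>n. \<not> (1/2 + 1 / real (Suc n) < \<bar>x - 1/2\<bar>)"
  proof (subst AE_all_countable, rule allI)
    fix n
    show "AE x in P. \<not> (1/2 + 1 / real (Suc n) < \<bar>x - 1/2\<bar>)"
      by (rule AE_I[where N="{x. 1/2 + 1 / real (Suc n) < \<bar>x - 1/2\<bar>}"])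
         (use zero[of "1 / real (Suc n)"] meas in \<open>auto simp: G_def emeasure_eq_measure\<close>)
  qed
  then show ?thesis
  proof eventually_elim
    case (elim x)
    have "\<bar>x - 1/2\<bar> \<le> 1/2"
    proof (rule ccontr)
      assume "\<not> ?thesis"
      then obtain n where "inverse (real (Suc n)) < \<bar>x - 1/2\<bar> - 1/2"
        using reals_Archimedean[of "\<bar>x - 1/2\<bar> - 1/2"] by auto
      then show False using elim[rule_format, of n] by (simp add: inverse_eq_divide)
    qed
    then show ?case by (auto simp: abs_if split: if_splits)
  qed
qed

text \<open>
  A point of the unit interval has at most one preimage in the unit interval under the two maps,
  so each application of the self-similarity halves the largest possible mass of a point. Having
  no atoms makes the boundaries of Voronoi regions negligible, also when a boundary touches the
  support, as happens at the two extreme ratios.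
\<close>

lemma prob_singleton: "prob {x} = 0"
proof -
  have outside: "prob {x} = 0" if "x \<notin> {0..1}" for x
  proof -
    have "AE y in P. y \<noteq> x"
      using AE_unit_interval by eventually_elim (use that in auto)
    then show ?thesis
      by (subst (asm) AE_iff_measurable[of "{x}"]) (auto simp: measure_def)
  qed
  have pre: "S r 1 -` {x} = {x / r}" "S r 2 -` {x} = {(x - (1 - r)) / r}" for x
    using r_pos by (auto simp: S_def field_simps)
  have "prob {x} \<le> (1/2) ^ n" for n
  proof (induction n arbitrary: x)
    case (Suc n)
    have eq: "prob {x} = 1/2 * prob {x / r} + 1/2 * prob {(x - (1 - r)) / r}"
      using prob_split[of "{x}"] by (simp add: pre[simplified])
    show ?case
    proof (cases "x / r \<in> {0..1}")
      case True
      then have "(x - (1 - r)) / r < 0"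
        using r_pos r_half by (auto simp: field_simps)
      then show ?thesis using eq outside[of "(x - (1 - r)) / r"] Suc[of "x / r"] by auto
    next
      case False
      then show ?thesis using eq outside[of "x / r"] Suc[of "(x - (1 - r)) / r"] by auto
    qed
  qed simp
  then have "prob {x} \<le> 0"
    using LIMSEQ_le_const[OF LIMSEQ_realpow_zero[of "1/2::real"]] by auto
  then show ?thesis by (simp add: measure_le_0_iff)
qed

lemma AE_not_eq: "AE x in P. x \<noteq> c"
  by (rule AE_I[where N="{c}"]) (auto simp: emeasure_eq_measure prob_singleton)

lemma AE_open_unit_interval: "AE x in P. 0 < x \<and> x < 1"
  using AE_unit_interval AE_not_eq[of 0] AE_not_eq[of 1] by eventually_elim auto

lemma integrable_on_unit:
  fixes f :: "real \<Rightarrow> real"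
  assumes "f \<in> borel_measurable borel" and "\<And>x. x \<in> {0..1} \<Longrightarrow> \<bar>f x\<bar> \<le> B"
  shows "integrable P f"
proof (rule integrable_const_bound[where B=B])
  show "AE x in P. norm (f x) \<le> B"
    using AE_unit_interval by eventually_elim (use assms in simp)
qed (use assms in simp)

lemma integrable_power [simp]: "integrable P (\<lambda>x. x ^ n)"
  by (rule integrable_on_unit[where B=1]) (auto simp: power_le_one)

lemma integrable_id [simp]: "integrable P (\<lambda>x. x)"
  using integrable_power[of 1] by simp

lemma mean: "(LINT x|P. x) = 1/2"
proof -
  define M where "M = (LINT x|P. x)"
  have "M = r * M + (1 - r) / 2"
    using expectation_split[OF integrable_id] prob_UNIV
    by (simp add: S_simps M_def[symmetric] field_simps)
  then have "(M - 1/2) * (1 - r) = 0" by (simp add: field_simps)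
  then show ?thesis using r_half by (simp add: M_def)
qed


section \<open>Cells of the Cantor set and centroids of their unions\<close>

lemma S_affine: "S r i x = r * x + S r i 0"
  by (simp add: S_def)

lemma S_eq_iff [simp]: "S r i x = S r i y \<longleftrightarrow> x = y"
  using r_pos by (simp add: S_def)

lemma S_ranges_disjoint:
  assumes "x \<in> {0..1}" "y \<in> {0..1}" "{i, j} = {1, 2}"
  shows "S r i x \<noteq> S r j y"
proof -
  have "r * x \<le> r" "r * y \<le> r" "0 \<le> r * x" "0 \<le> r * y"
    using assms r_pos mult_left_mono[of x 1 r] mult_left_mono[of y 1 r] by auto
  then show ?thesis
    using assms(3) r_half by (auto simp: S_def doubleton_eq_iff)
qed

lemma image_S_borel [measurable]:
  assumes "B \<in> sets borel"
  shows "S r i ` B \<in> sets borel"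
proof -
  have "S r i ` B = (\<lambda>y. (y - S r i 0) / r) -` B"
  proof (intro set_eqI iffI)
    fix y assume "y \<in> (\<lambda>y. (y - S r i 0) / r) -` B"
    moreover have "y = S r i ((y - S r i 0) / r)"
      using r_pos by (subst S_affine) simp
    ultimately show "y \<in> S r i ` B" by blast
  qed (use r_pos in \<open>auto simp: S_def\<close>)
  moreover have "(\<lambda>y. (y - S r i 0) / r) \<in> borel_measurable borel" by measurable
  ultimately show ?thesis
    using measurable_sets_borel[of "\<lambda>y. (y - S r i 0) / r" borel B] assms by simp
qed

lemma S_word_append: "S_word r (\<sigma> @ \<tau>) = S_word r \<sigma> \<circ> S_word r \<tau>"
  by (induction \<sigma>) auto

lemma S_word_affine: "S_word r \<sigma> x = r ^ length \<sigma> * x + S_word r \<sigma> 0"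
proof (induction \<sigma>)
  case (Cons i \<sigma>)
  show ?case
    using S_affine[of i "S_word r \<sigma> x"] S_affine[of i "S_word r \<sigma> 0"] Cons.IH
    by (simp add: algebra_simps)
qed simp

lemma S_word_mem_unit: "x \<in> {0..1} \<Longrightarrow> S_word r \<sigma> x \<in> {0..1}"
  by (induction \<sigma>) (auto simp del: atLeastAtMost_iff intro: S_mem_unit)

lemma J_Nil [simp]: "J r [] = {0..1}"
  by (simp add: J_def)

lemma J_Cons: "J r (i # \<sigma>) = S r i ` J r \<sigma>"
  by (auto simp: J_def)

lemma J_append: "J r (\<sigma> @ \<tau>) = S_word r \<sigma> ` J r \<tau>"
  by (simp add: J_def S_word_append image_comp)

lemma J_subset_unit: "J r \<sigma> \<subseteq> {0..1}"
  unfolding J_def using S_word_mem_unit by blast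

lemma J_borel [measurable, simp]: "J r \<sigma> \<in> sets borel"
  by (induction \<sigma>) (auto simp: J_Cons intro: image_S_borel)

lemma J_bounds:
  assumes "x \<in> J r \<sigma>"
  shows "S_word r \<sigma> 0 \<le> x" "x \<le> S_word r \<sigma> 1"
proof -
  obtain y where y: "y \<in> {0..1}" "x = S_word r \<sigma> y"
    using assms by (auto simp: J_def)
  have "0 \<le> r ^ length \<sigma> * y" "r ^ length \<sigma> * y \<le> r ^ length \<sigma>"
    using y(1) r_pos mult_left_mono[of y 1 "r ^ length \<sigma>"] by auto
  then show "S_word r \<sigma> 0 \<le> x" "x \<le> S_word r \<sigma> 1"
    using y(2) S_word_affine[of \<sigma> y] S_word_affine[of \<sigma> 1] by auto
qed

text \<open>
  The left-to-right order of disjoint cells: two words are compared at the first place where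
  they differ. Words of which one is a prefix of the other are incomparable, because their cells
  are nested.
\<close>

fun left_of :: "word \<Rightarrow> word \<Rightarrow> bool" where
  "left_of (i # \<sigma>) (j # \<tau>) \<longleftrightarrow> i = 1 \<and> j = 2 \<or> i = j \<and> left_of \<sigma> \<tau>"
| "left_of _ _ \<longleftrightarrow> False"

lemma left_of_endpoints: "left_of \<sigma> \<tau> \<Longrightarrow> S_word r \<sigma> 1 < S_word r \<tau> 0"
proof (induction \<sigma> \<tau> rule: left_of.induct)
  case (1 i \<sigma> j \<tau>)
  show ?case
  proof (cases "i = j")
    case True
    then show ?thesis using 1 r_pos by (auto simp: S_def)
  next
    case False
    have "S_word r \<sigma> 1 \<in> {0..1}" "S_word r \<tau> 0 \<in> {0..1}"
      by (intro S_word_mem_unit, simp)+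
    then have "r * S_word r \<sigma> 1 \<le> r" "0 \<le> r * S_word r \<tau> 0"
      using r_pos mult_left_mono[of "S_word r \<sigma> 1" 1 r] by auto
    then show ?thesis using False 1(2) r_half by (simp add: S_def)
  qed
qed auto

lemma set_integrable_P:
  fixes f :: "real \<Rightarrow> real"
  shows "B \<in> sets borel \<Longrightarrow> integrable P f \<Longrightarrow> set_integrable P B f"
  unfolding set_integrable_def by (rule integrable_mult_indicator) simp_all

lemma set_integral_one: "B \<in> sets borel \<Longrightarrow> (LINT x:B|P. 1) = prob B"
  using set_integral_const[of B P "1::real"] by (simp add: emeasure_eq_measure)

lemma expectation_one_branch:
  fixes g :: "real \<Rightarrow> real"
  assumes "integrable P g" "{i, j} = {1, 2}" "AE x in P. g (S r j x) = 0"
  shows "(LINT x|P. g x) = 1/2 * (LINT x|P. g (S r i x))"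
proof -
  have "(LINT x|P. g (S r j x)) = 0"
    using assms(3) by (rule integral_eq_zero_AE)
  then show ?thesis
    using expectation_split[OF assms(1)] assms(2) by (auto simp: doubleton_eq_iff)
qed

lemma set_integral_image_S:
  fixes f :: "real \<Rightarrow> real"
  assumes "B \<in> sets borel" "B \<subseteq> {0..1}" "integrable P f" "i \<in> {1,2}"
  shows "(LINT x:S r i ` B|P. f x) = 1/2 * (LINT x:B|P. f (S r i x))"
proof -
  obtain j where ij: "{i, j} = {1, 2}" using assms(4) by auto
  have "AE x in P. indicator (S r i ` B) (S r j x) *\<^sub>R f (S r j x) = 0"
    using AE_unit_interval
  proof eventually_elim
    case (elim x)
    then have "S r j x \<notin> S r i ` B"
      using S_ranges_disjoint[OF _ _ ij] assms(2) by force
    then show ?case by simp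
  qed
  moreover have "integrable P (\<lambda>x. indicator (S r i ` B) x *\<^sub>R f x)"
    using set_integrable_P[OF image_S_borel[OF assms(1)] assms(3)] by (simp add: set_integrable_def)
  ultimately have "(LINT x:S r i ` B|P. f x) =
      1/2 * (LINT x|P. indicator (S r i ` B) (S r i x) *\<^sub>R f (S r i x))"
    unfolding set_lebesgue_integral_def by (intro expectation_one_branch[OF _ ij])
  moreover have "indicator (S r i ` B) (S r i x) = (indicator B x :: real)" for x
    by (auto simp: indicator_def)
  ultimately show ?thesis by (simp add: set_lebesgue_integral_def)
qed

lemma image_S_word_Cons: "S_word r (i # \<sigma>) ` B = S r i ` S_word r \<sigma> ` B"
  by auto

lemma image_S_word_borel: "B \<in> sets borel \<Longrightarrow> S_word r \<sigma> ` B \<in> sets borel"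
proof (induction \<sigma>)
  case (Cons i \<sigma>)
  then show ?case unfolding image_S_word_Cons by (intro image_S_borel)
qed simp

lemma set_integral_image_S_word:
  fixes f :: "real \<Rightarrow> real"
  assumes "B \<in> sets borel" "B \<subseteq> {0..1}" "integrable P f" "set \<sigma> \<subseteq> {1,2}"
  shows "(LINT x:S_word r \<sigma> ` B|P. f x) = (1/2) ^ length \<sigma> * (LINT x:B|P. f (S_word r \<sigma> x))"
  using assms(3,4)
proof (induction \<sigma> arbitrary: f)
  case (Cons i \<sigma>)
  have "S_word r \<sigma> ` B \<subseteq> {0..1}" using S_word_mem_unit assms(2) by blast
  then have "(LINT x:S_word r (i # \<sigma>) ` B|P. f x) = 1/2 * (LINT x:S_word r \<sigma> ` B|P. f (S r i x))"
    using set_integral_image_S[of "S_word r \<sigma> ` B" f i] Cons.prems assms(1)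
    by (simp only: image_S_word_Cons) (simp add: image_S_word_borel)
  then show ?case
    using Cons.IH[of "\<lambda>x. f (S r i x)"] Cons.prems integrable_comp_S[of f i] by simp
qed simp

lemma prob_image_S_word:
  assumes "B \<in> sets borel" "B \<subseteq> {0..1}" "set \<sigma> \<subseteq> {1,2}"
  shows "prob (S_word r \<sigma> ` B) = (1/2) ^ length \<sigma> * prob B"
  using set_integral_image_S_word[OF assms(1,2) integrable_const assms(3), of 1] assms(1)
  by (simp add: set_integral_one image_S_word_borel)

lemma set_integral_affine:
  assumes "B \<in> sets borel"
  shows "(LINT x:B|P. u * x + v) = u * (LINT x:B|P. x) + v * prob B"
proof -
  have "set_integrable P B (\<lambda>x. u * x)" "set_integrable P B (\<lambda>x. v)"
    using assms by (auto intro!: set_integrable_P)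
  then have "(LINT x:B|P. u * x + v) = (LINT x:B|P. u * x) + (LINT x:B|P. v * 1)"
    by (subst set_integral_add(2)) auto
  also have "\<dots> = u * (LINT x:B|P. x) + v * (LINT x:B|P. 1)"
    by (simp only: set_integral_mult_right)
  finally show ?thesis using assms by (simp add: set_integral_one)
qed

lemma centroid_image_S_word:
  assumes "B \<in> sets borel" "B \<subseteq> {0..1}" "prob B > 0" "set \<sigma> \<subseteq> {1,2}"
  shows "centroid P (S_word r \<sigma> ` B) = S_word r \<sigma> (centroid P B)"
proof -
  have "(LINT x:S_word r \<sigma> ` B|P. x) = (1/2) ^ length \<sigma> * (LINT x:B|P. S_word r \<sigma> x)"
    using assms by (intro set_integral_image_S_word) auto
  also have "(LINT x:B|P. S_word r \<sigma> x) =
      r ^ length \<sigma> * (LINT x:B|P. x) + S_word r \<sigma> 0 * prob B"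
    using set_integral_affine[OF assms(1), of "r ^ length \<sigma>" "S_word r \<sigma> 0"]
    by (simp add: S_word_affine[symmetric])
  finally show ?thesis
    using assms S_word_affine[of \<sigma> "centroid P B"]
    by (simp add: centroid_def prob_image_S_word field_simps)
qed

lemma prob_unit: "prob {0..1} = 1"
  using AE_unit_interval by (simp add: prob_eq_1)

lemma set_integral_unit: "(LINT x:{0..1}|P. x) = 1/2"
proof -
  have "(LINT x:{0..1}|P. x) = (LINT x|P. x)"
    unfolding set_lebesgue_integral_def
    by (rule integral_cong_AE)
       (use AE_unit_interval in \<open>auto simp del: atLeastAtMost_iff elim!: eventually_mono\<close>)
  then show ?thesis by (simp add: mean)
qed

text \<open>
  The mass of a union of cells and its unnormalised first moment, as explicit functions of the
  words.
\<close>

definition weight :: "word list \<Rightarrow> real" where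
  "weight ws = (\<Sum>\<sigma>\<leftarrow>ws. (1/2) ^ length \<sigma>)"

definition moment :: "word list \<Rightarrow> real" where
  "moment ws = (\<Sum>\<sigma>\<leftarrow>ws. (1/2) ^ length \<sigma> * S_word r \<sigma> (1/2))"

definition cells :: "word list \<Rightarrow> real set" where
  "cells ws = (\<Union>\<sigma>\<in>set ws. J r \<sigma>)"

text \<open>
  Cells listed from left to right; in particular they are pairwise disjoint.
\<close>

definition ordered :: "word list \<Rightarrow> bool" where
  "ordered ws \<longleftrightarrow> sorted_wrt left_of ws \<and> (\<forall>\<sigma>\<in>set ws. set \<sigma> \<subseteq> {1,2})"

lemma cells_borel [measurable, simp]: "cells ws \<in> sets borel"
  by (auto simp: cells_def)

lemma cells_subset_unit: "cells ws \<subseteq> {0..1}"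
  using J_subset_unit by (auto simp: cells_def)

lemma
  assumes "ordered ws"
  shows prob_cells: "prob (cells ws) = weight ws"
    and integral_cells: "(LINT x:cells ws|P. x) = moment ws"
proof -
  have J: "prob (J r \<sigma>) = (1/2) ^ length \<sigma>"
    "(LINT x:J r \<sigma>|P. x) = (1/2) ^ length \<sigma> * S_word r \<sigma> (1/2)" if \<sigma>: "set \<sigma> \<subseteq> {1,2}" for \<sigma>
  proof -
    show prob: "prob (J r \<sigma>) = (1/2) ^ length \<sigma>"
      using prob_image_S_word[of "{0..1}" \<sigma>] \<sigma> by (simp add: J_def prob_unit)
    have "centroid P (J r \<sigma>) = S_word r \<sigma> (1/2)"
      using centroid_image_S_word[of "{0..1}" \<sigma>] \<sigma>
      by (simp add: J_def centroid_def[of P "{0..1}"] prob_unit set_integral_unit)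
    then show "(LINT x:J r \<sigma>|P. x) = (1/2) ^ length \<sigma> * S_word r \<sigma> (1/2)"
      by (simp add: centroid_def prob field_simps)
  qed
  have "prob (cells ws) = weight ws \<and> (LINT x:cells ws|P. x) = moment ws"
    using assms
  proof (induction ws)
    case Nil
    then show ?case by (simp add: cells_def weight_def moment_def set_lebesgue_integral_def)
  next
    case (Cons \<sigma> ws)
    have eq: "cells (\<sigma> # ws) = J r \<sigma> \<union> cells ws" by (simp add: cells_def)
    have disj: "J r \<sigma> \<inter> cells ws = {}"
      unfolding cells_def
    proof (intro equals0I, clarify)
      fix x \<tau> assume x: "x \<in> J r \<sigma>" "\<tau> \<in> set ws" "x \<in> J r \<tau>"
      then have "S_word r \<sigma> 1 < S_word r \<tau> 0"
        using Cons.prems by (simp add: ordered_def left_of_endpoints)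
      then show False using J_bounds(2)[OF x(1)] J_bounds(1)[OF x(3)] by linarith
    qed
    have IH: "prob (cells ws) = weight ws" "(LINT x:cells ws|P. x) = moment ws"
      using Cons by (auto simp: ordered_def)
    have \<sigma>: "set \<sigma> \<subseteq> {1,2}" using Cons.prems by (simp add: ordered_def)
    have "prob (cells (\<sigma> # ws)) = prob (J r \<sigma>) + prob (cells ws)"
      unfolding eq by (rule finite_measure_Union) (use disj in auto)
    moreover have "(LINT x:cells (\<sigma> # ws)|P. x) = (LINT x:J r \<sigma>|P. x) + (LINT x:cells ws|P. x)"
      unfolding eq by (rule set_integral_Un) (use disj in \<open>auto intro!: set_integrable_P\<close>)
    ultimately show ?case using J[OF \<sigma>] IH by (simp add: weight_def moment_def)
  qed
  then show "prob (cells ws) = weight ws" "(LINT x:cells ws|P. x) = moment ws" by auto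
qed

lemma weight_pos: "ws \<noteq> [] \<Longrightarrow> weight ws > 0"
proof (induction ws)
  case (Cons \<sigma> ws)
  then show ?case by (cases "ws = []") (auto simp: weight_def add_pos_pos)
qed simp

lemma a_eq_moment_div_weight: "ordered ws \<Longrightarrow> a r P ws = moment ws / weight ws"
  using prob_cells[of ws] integral_cells[of ws] by (simp add: a_def centroid_def cells_def)

text \<open>
  Since \<^term>\<open>S_word r \<sigma>\<close> is affine and scales the measure by a constant,
  it commutes with centroids. Every three-point set of the theorem is therefore the image of one
  that belongs to the empty word.
\<close>

lemma a_map_append:
  assumes "ordered ws" "ws \<noteq> []" "set \<sigma> \<subseteq> {1,2}"
  shows "a r P (map ((@) \<sigma>) ws) = S_word r \<sigma> (a r P ws)"
proof -
  have "(\<Union>\<tau>\<in>set (map ((@) \<sigma>) ws). J r \<tau>) = S_word r \<sigma> ` cells ws"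
    by (auto simp: cells_def J_append)
  then show ?thesis
    using centroid_image_S_word[OF cells_borel cells_subset_unit _ assms(3), of ws] weight_pos assms
    by (simp add: a_def prob_cells) (simp add: cells_def)
qed

section \<open>Voronoi regions and the distortion of a tessellation\<close>

lemma voronoi_iff:
  assumes "finite \<alpha>" "b \<in> \<alpha>"
  shows "x \<in> voronoi b \<alpha> \<longleftrightarrow> (\<forall>c\<in>\<alpha>. \<bar>x - b\<bar> \<le> \<bar>x - c\<bar>)"
proof -
  have "\<bar>x - b\<bar> = Min ((\<lambda>c. \<bar>x - c\<bar>) ` \<alpha>) \<longleftrightarrow> (\<forall>c\<in>\<alpha>. \<bar>x - b\<bar> \<le> \<bar>x - c\<bar>)"
    using assms by (subst eq_commute, subst Min_eq_iff) auto
  then show ?thesis by (simp add: voronoi_def)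
qed

lemma voronoi_borel [measurable, simp]:
  assumes "finite \<alpha>"
  shows "voronoi b \<alpha> \<in> sets borel"
proof -
  have [measurable]: "(\<lambda>x::real. Min ((\<lambda>c. \<bar>x - c\<bar>) ` \<alpha>)) \<in> borel_measurable borel"
    using assms by (intro borel_measurable_Min) auto
  show ?thesis unfolding voronoi_def by measurable
qed

lemma ex_nearest:
  fixes x :: real
  assumes "finite \<alpha>" "\<alpha> \<noteq> {}"
  shows "\<exists>b\<in>\<alpha>. \<forall>c\<in>\<alpha>. \<bar>x - b\<bar> \<le> \<bar>x - c\<bar>"
  using arg_min_if_finite(1)[OF assms, of "\<lambda>c. \<bar>x - c\<bar>"] arg_min_least[OF assms, of _ "\<lambda>c. \<bar>x - c\<bar>"]
  by blast

text \<open>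
  A point that is nearest to two different \<open>b\<close> and \<open>c\<close> is their
  midpoint, and there are finitely many midpoints.
\<close>

lemma AE_nearest_unique:
  assumes "finite \<alpha>"
  shows "AE x in P. \<forall>b\<in>\<alpha>. \<forall>c\<in>\<alpha>. x \<in> voronoi b \<alpha> \<longrightarrow> x \<in> voronoi c \<alpha> \<longrightarrow> b = c"
proof -
  have "AE x in P. \<forall>b\<in>\<alpha>. \<forall>c\<in>\<alpha>. x \<noteq> (b + c) / 2"
    using assms by (intro AE_finite_allI AE_not_eq)
  then show ?thesis
  proof eventually_elim
    case (elim x)
    show ?case
    proof (intro ballI impI)
      fix b c assume bc: "b \<in> \<alpha>" "c \<in> \<alpha>" "x \<in> voronoi b \<alpha>" "x \<in> voronoi c \<alpha>"
      then have "\<bar>x - b\<bar> = \<bar>x - c\<bar>" "x \<noteq> (b + c) / 2"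
        using elim by (auto simp: voronoi_iff assms intro: antisym)
      then show "b = c" by (auto simp: abs_if field_simps split: if_splits)
    qed
  qed
qed

lemma prob_cong_AE:
  assumes "A \<in> sets borel" "B \<in> sets borel" "AE x in P. x \<in> A \<longleftrightarrow> x \<in> B"
  shows "prob A = prob B"
  using assms by (intro measure_eq_AE) auto

lemma set_integral_cong_AE_set:
  fixes f :: "real \<Rightarrow> real"
  assumes "A \<in> sets borel" "B \<in> sets borel" "AE x in P. x \<in> A \<longleftrightarrow> x \<in> B" "integrable P f"
  shows "(LINT x:A|P. f x) = (LINT x:B|P. f x)"
proof (rule set_integral_cong_set)
  show "AE x in P. x \<in> B \<longleftrightarrow> x \<in> A" using assms(3) by eventually_elim auto
  have [measurable]: "f \<in> borel_measurable P" using assms(4) by auto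
  show "set_borel_measurable P A f" "set_borel_measurable P B f"
    unfolding set_borel_measurable_def using assms(1,2) by measurable
qed

lemma centroid_cong_AE:
  assumes "A \<in> sets borel" "B \<in> sets borel" "AE x in P. x \<in> A \<longleftrightarrow> x \<in> B"
  shows "centroid P A = centroid P B"
  unfolding centroid_def using prob_cong_AE[OF assms] set_integral_cong_AE_set[OF assms integrable_id]
  by simp

text \<open>
  The criterion behind all explicit tessellations: it is enough to find, for each point, a piece
  of the support inside its Voronoi region whose centroid is that point. If the pieces exhaust
  the support, there is no mass left, so each region agrees with its piece up to a null set.
\<close>

lemma
  fixes c :: "'k \<Rightarrow> real"
  assumes K: "finite K" "inj_on c K"
    and borel: "\<And>k. k \<in> K \<Longrightarrow> U k \<in> sets borel"
    and sub: "\<And>k. k \<in> K \<Longrightarrow> U k \<subseteq> voronoi (c k) (c ` K)"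
    and cover: "AE x in P. x \<in> (\<Union>k\<in>K. U k)"
    and pos: "\<And>k. k \<in> K \<Longrightarrow> prob (U k) > 0"
    and centre: "\<And>k. k \<in> K \<Longrightarrow> centroid P (U k) = c k"
  shows CVT_of_partition: "is_CVT P (card K) (c ` K)"
    and prob_voronoi_of_partition: "k \<in> K \<Longrightarrow> prob (voronoi (c k) (c ` K)) = prob (U k)"
proof -
  \<comment> \<open>A location of the region lies in some piece, hence in the region of that piece; by uniqueness the two agree.\<close>
  have ae: "AE x in P. x \<in> voronoi (c k) (c ` K) \<longleftrightarrow> x \<in> U k" if k: "k \<in> K" for k
    using AE_nearest_unique[OF finite_imageI[OF K(1), of c]] cover
  proof eventually_elim
    case (elim x)
    have "x \<in> U k" if "x \<in> voronoi (c k) (c ` K)"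
    proof -
      obtain j where j: "j \<in> K" "x \<in> U j" using elim(2) by blast
      then have "x \<in> voronoi (c j) (c ` K)" using sub by blast
      then have "c j = c k" using elim(1) that k j(1) by blast
      then show ?thesis using inj_onD[OF K(2)] j k by blast
    qed
    then show ?case using sub[OF k] by blast
  qed
  show prob_eq: "prob (voronoi (c k) (c ` K)) = prob (U k)" if "k \<in> K" for k
    using ae[OF that] borel[OF that] K(1) by (intro prob_cong_AE) auto
  have "c k = centroid P (voronoi (c k) (c ` K))" if "k \<in> K" for k
    using centroid_cong_AE[OF _ borel[OF that] ae[OF that]] centre[OF that] K(1) by simp
  then show "is_CVT P (card K) (c ` K)"
    using K pos prob_eq by (auto simp: is_CVT_def card_image)
qed

lemma Min_sq_eq:
  fixes x :: real
  assumes "finite \<alpha>" "b \<in> \<alpha>" "\<And>c. c \<in> \<alpha> \<Longrightarrow> \<bar>x - b\<bar> \<le> \<bar>x - c\<bar>"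
  shows "Min ((\<lambda>b. (x - b)\<^sup>2) ` \<alpha>) = (x - b)\<^sup>2"
  using assms by (intro Min_eqI) (auto simp: abs_le_square_iff)

text \<open>
  On the Voronoi region of \<open>b\<close> the squared distance is \<open>x\<^sup>2 - (2 * b *
  x - b\<^sup>2)\<close>, and the integral of the bracket over the region is the mass times
  \<open>b\<^sup>2\<close>, because \<open>b\<close> is the centroid. Tessellations can thus be
  compared without a second moment of the measure.
\<close>

lemma distortion_of_CVT:
  assumes cvt: "is_CVT P n \<alpha>" and ne: "\<alpha> \<noteq> {}"
  shows "distortion P \<alpha> = (LINT x|P. x\<^sup>2) - (\<Sum>b\<in>\<alpha>. prob (voronoi b \<alpha>) * b\<^sup>2)"
proof -
  have fin: "finite \<alpha>" using cvt by (simp add: is_CVT_def)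
  let ?V = "\<lambda>b. voronoi b \<alpha>"
  have int: "integrable P (\<lambda>x. indicator (?V b) x * (2 * b * x - b\<^sup>2))" for b
    using set_integrable_P[of "?V b" "\<lambda>x. 2 * b * x - b\<^sup>2"] fin by (simp add: set_integrable_def)
  have "distortion P \<alpha> = (LINT x|P. x\<^sup>2 - (\<Sum>b\<in>\<alpha>. indicator (?V b) x * (2 * b * x - b\<^sup>2)))"
    unfolding distortion_def
  proof (rule integral_cong_AE)
    show "(\<lambda>x. Min ((\<lambda>b. (x - b)\<^sup>2) ` \<alpha>)) \<in> borel_measurable P"
      using fin by (intro borel_measurable_Min) auto
    show "(\<lambda>x. x\<^sup>2 - (\<Sum>b\<in>\<alpha>. indicator (?V b) x * (2 * b * x - b\<^sup>2))) \<in> borel_measurable P"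
      using fin by measurable
    show "AE x in P. Min ((\<lambda>b. (x - b)\<^sup>2) ` \<alpha>) =
        x\<^sup>2 - (\<Sum>b\<in>\<alpha>. indicator (?V b) x * (2 * b * x - b\<^sup>2))"
      using AE_nearest_unique[OF fin]
    proof eventually_elim
      case (elim x)
      obtain b where b: "b \<in> \<alpha>" "\<forall>c\<in>\<alpha>. \<bar>x - b\<bar> \<le> \<bar>x - c\<bar>"
        using ex_nearest[OF fin ne] by blast
      then have xb: "x \<in> ?V b" using fin by (simp add: voronoi_iff)
      have "(\<Sum>c\<in>\<alpha>. indicator (?V c) x * (2 * c * x - c\<^sup>2)) = (\<Sum>c\<in>\<alpha>. if c = b then 2 * b * x - b\<^sup>2 else 0)"
        by (rule sum.cong) (use elim b(1) xb in \<open>auto simp: indicator_def\<close>)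
      also have "\<dots> = 2 * b * x - b\<^sup>2" using fin b(1) by simp
      finally have sum: "(\<Sum>c\<in>\<alpha>. indicator (?V c) x * (2 * c * x - c\<^sup>2)) = 2 * b * x - b\<^sup>2" .
      have "Min ((\<lambda>b. (x - b)\<^sup>2) ` \<alpha>) = (x - b)\<^sup>2"
        using Min_sq_eq[OF fin b(1)] b(2) by blast
      then show ?case
        unfolding sum by (simp add: power2_eq_square algebra_simps)
    qed
  qed
  also have "\<dots> = (LINT x|P. x\<^sup>2) - (\<Sum>b\<in>\<alpha>. LINT x|P. indicator (?V b) x * (2 * b * x - b\<^sup>2))"
    using int by simp
  also have "(\<Sum>b\<in>\<alpha>. LINT x|P. indicator (?V b) x * (2 * b * x - b\<^sup>2)) = (\<Sum>b\<in>\<alpha>. prob (?V b) * b\<^sup>2)"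
  proof (rule sum.cong)
    fix b assume b: "b \<in> \<alpha>"
    then have pos: "prob (?V b) > 0" and "b = centroid P (?V b)"
      using cvt by (auto simp: is_CVT_def)
    then have mass: "(LINT x:?V b|P. x) = b * prob (?V b)"
      by (simp add: centroid_def field_simps)
    have "(LINT x|P. indicator (?V b) x * (2 * b * x - b\<^sup>2)) = (LINT x:?V b|P. 2 * b * x + (- b\<^sup>2))"
      by (simp add: set_lebesgue_integral_def)
    also have "\<dots> = 2 * b * (b * prob (?V b)) + (- b\<^sup>2) * prob (?V b)"
      using set_integral_affine[of "?V b" "2 * b" "- b\<^sup>2"] mass fin by simp
    finally show "(LINT x|P. indicator (?V b) x * (2 * b * x - b\<^sup>2)) = prob (?V b) * b\<^sup>2"
      by (simp add: power2_eq_square algebra_simps)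
  qed simp
  finally show ?thesis .
qed

section \<open>Gluing tessellations along the first level of the Cantor set\<close>

definition glue :: "(nat \<Rightarrow> real set) \<Rightarrow> real set" where
  "glue \<beta> = S r 1 ` \<beta> 1 \<union> S r 2 ` \<beta> 2"

text \<open>
  The end points \<open>0\<close> and \<open>1\<close> are left out because there the comparison
  can become an equality: this happens when one codebook stays as far away from the gap as
  gluing permits and the other one has a point at its edge.
\<close>

definition separated :: "(nat \<Rightarrow> real set) \<Rightarrow> bool" where
  "separated \<beta> \<longleftrightarrow> (\<forall>i j. {i, j} = {1, 2} \<longrightarrow> (\<forall>x b. 0 < x \<longrightarrow> x < 1 \<longrightarrow> b \<in> \<beta> j \<longrightarrow>
     (\<exists>c\<in>\<beta> i. \<bar>S r i x - S r i c\<bar> < \<bar>S r i x - S r j b\<bar>)))"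

lemma dist_S: "\<bar>S r i x - S r i y\<bar> = r * \<bar>x - y\<bar>"
proof -
  have "S r i x - S r i y = r * (x - y)" by (simp add: S_def right_diff_distrib)
  then show ?thesis using r_pos by (simp add: abs_mult)
qed

lemma glue_eq: "{i, j} = {1, 2} \<Longrightarrow> glue \<beta> = S r i ` \<beta> i \<union> S r j ` \<beta> j"
  by (auto simp: glue_def doubleton_eq_iff)

lemma
  assumes sep: "separated \<beta>" and fin: "finite (\<beta> 1)" "finite (\<beta> 2)"
    and ij: "{i, j} = {1, 2}" and b: "b \<in> \<beta> i" and x: "0 < x" "x < 1"
  shows voronoi_glue_same: "S r i x \<in> voronoi (S r i b) (glue \<beta>) \<longleftrightarrow> x \<in> voronoi b (\<beta> i)"
    and voronoi_glue_other: "S r j x \<notin> voronoi (S r i b) (glue \<beta>)"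
proof -
  have fin': "finite (glue \<beta>)" "finite (\<beta> i)" and bg: "S r i b \<in> glue \<beta>"
    using fin ij b by (auto simp: glue_def doubleton_eq_iff)
  have "{j, i} = {1, 2}" using ij by blast
  then obtain c where c: "c \<in> \<beta> j" "\<bar>S r j x - S r j c\<bar> < \<bar>S r j x - S r i b\<bar>"
    using sep x b unfolding separated_def by blast
  have "S r j c \<in> glue \<beta>" using c(1) glue_eq[OF ij] by blast
  then show "S r j x \<notin> voronoi (S r i b) (glue \<beta>)"
    using voronoi_iff[OF fin'(1) bg] c(2) by force
  \<comment> \<open>A point of the other half never beats the own half, so it can be dropped from the comparison.\<close>
  have "(\<forall>c\<in>\<beta> j. \<bar>S r i x - S r i b\<bar> \<le> \<bar>S r i x - S r j c\<bar>)"
    if near: "\<forall>c\<in>\<beta> i. \<bar>S r i x - S r i b\<bar> \<le> \<bar>S r i x - S r i c\<bar>"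
  proof
    fix c assume "c \<in> \<beta> j"
    then obtain d where "d \<in> \<beta> i" "\<bar>S r i x - S r i d\<bar> < \<bar>S r i x - S r j c\<bar>"
      using sep x ij unfolding separated_def by blast
    then show "\<bar>S r i x - S r i b\<bar> \<le> \<bar>S r i x - S r j c\<bar>" using near by force
  qed
  then have "S r i x \<in> voronoi (S r i b) (glue \<beta>) \<longleftrightarrow>
      (\<forall>c\<in>\<beta> i. \<bar>S r i x - S r i b\<bar> \<le> \<bar>S r i x - S r i c\<bar>)"
    using voronoi_iff[OF fin'(1) bg] by (auto simp: glue_eq[OF ij])
  then show "S r i x \<in> voronoi (S r i b) (glue \<beta>) \<longleftrightarrow> x \<in> voronoi b (\<beta> i)"
    using voronoi_iff[OF fin'(2) b] r_pos by (simp add: dist_S)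
qed

text \<open>
  By the two preceding facts each region of the glued codebook is, up to a null set, the image
  of a region of one half under a similarity of ratio \<open>r\<close> that halves mass.
  Centroids are carried along, and squared distances shrink by \<open>r\<^sup>2\<close>.
\<close>

lemma
  assumes cvt: "is_CVT P (n 1) (\<beta> 1)" "is_CVT P (n 2) (\<beta> 2)"
    and ne: "\<beta> 1 \<noteq> {}" "\<beta> 2 \<noteq> {}"
    and unit: "\<beta> 1 \<subseteq> {0..1}" "\<beta> 2 \<subseteq> {0..1}"
    and sep: "separated \<beta>"
  shows is_CVT_glue: "is_CVT P (n 1 + n 2) (glue \<beta>)"
    and distortion_glue: "distortion P (glue \<beta>) = r\<^sup>2 / 2 * (distortion P (\<beta> 1) + distortion P (\<beta> 2))"
proof -
  have fin: "finite (\<beta> 1)" "finite (\<beta> 2)" and card: "card (\<beta> 1) = n 1" "card (\<beta> 2) = n 2"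
    using cvt by (auto simp: is_CVT_def)
  have fing: "finite (glue \<beta>)" using fin by (simp add: glue_def)
  have "S r 1 ` \<beta> 1 \<inter> S r 2 ` \<beta> 2 = {}"
    using S_ranges_disjoint[of _ _ 1 2] unit by blast
  then have "card (glue \<beta>) = n 1 + n 2"
    using fin card by (simp add: glue_def card_Un_disjoint card_image inj_on_def)
  moreover have "prob (voronoi (S r i b) (glue \<beta>)) > 0 \<and>
      S r i b = centroid P (voronoi (S r i b) (glue \<beta>))"
    if ij: "{i, j} = {1, 2}" and b: "b \<in> \<beta> i" for i j b
  proof -
    let ?G = "voronoi (S r i b) (glue \<beta>)" and ?V = "voronoi b (\<beta> i)"
    have i: "i \<in> {1, 2}" using ij by blast
    have vor: "prob ?V > 0" "b = centroid P ?V" and fini: "finite (\<beta> i)"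
      using cvt i b fin by (auto simp: is_CVT_def)
    have mass: "(LINT x:?V|P. x) = b * prob ?V"
      using vor by (simp add: centroid_def field_simps)
    \<comment> \<open>Up to end points, seen from the other half the region is empty, and seen from its own half it is the old region.\<close>
    have restrict: "(LINT x:?G|P. f x) = 1/2 * (LINT x:?V|P. f (S r i x))"
      if f: "integrable P f" for f :: "real \<Rightarrow> real"
    proof -
      have "AE x in P. indicator ?G (S r j x) *\<^sub>R f (S r j x) = 0"
        using AE_open_unit_interval
        by eventually_elim (use voronoi_glue_other[OF sep fin ij b] in simp)
      moreover have "integrable P (\<lambda>x. indicator ?G x *\<^sub>R f x)"
        using set_integrable_P[OF voronoi_borel[OF fing] f] by (simp add: set_integrable_def)
      ultimately have "(LINT x:?G|P. f x) = 1/2 * (LINT x|P. indicator ?G (S r i x) *\<^sub>R f (S r i x))"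
        unfolding set_lebesgue_integral_def by (intro expectation_one_branch[OF _ ij])
      also have "(LINT x|P. indicator ?G (S r i x) *\<^sub>R f (S r i x)) = (LINT x:?V|P. f (S r i x))"
        unfolding set_lebesgue_integral_def
      proof (rule integral_cong_AE)
        have [measurable]: "f \<in> borel_measurable borel"
          using borel_measurable_integrable[OF f] by simp
        show "(\<lambda>x. indicator ?G (S r i x) *\<^sub>R f (S r i x)) \<in> borel_measurable P"
          "(\<lambda>x. indicator ?V x *\<^sub>R f (S r i x)) \<in> borel_measurable P"
          using fing fini by measurable
        show "AE x in P. indicator ?G (S r i x) *\<^sub>R f (S r i x) = indicator ?V x *\<^sub>R f (S r i x)"
          using AE_open_unit_interval
          by eventually_elim (use voronoi_glue_same[OF sep fin ij b] in \<open>simp add: indicator_def\<close>)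
      qed
      finally show ?thesis .
    qed
    have prob: "prob ?G = 1/2 * prob ?V"
      using restrict[of "\<lambda>_. 1"] fing fini by (simp add: set_integral_one)
    then have pos: "prob ?G > 0" using vor(1) by simp
    have "(LINT x:?G|P. x) = 1/2 * (LINT x:?V|P. r * x + S r i 0)"
      using restrict[OF integrable_id] by (simp add: S_affine[of i, symmetric])
    also have "\<dots> = 1/2 * (r * (b * prob ?V) + S r i 0 * prob ?V)"
      using mass fini by (simp add: set_integral_affine)
    also have "\<dots> = (r * b + S r i 0) * prob ?G"
      unfolding prob by (simp add: algebra_simps)
    finally have "centroid P ?G = r * b + S r i 0"
      using pos by (simp add: centroid_def)
    then show ?thesis using vor(1) prob S_affine[of i b] by simp
  qed
  from this[of 1 2] this[of 2 1] have "\<forall>c\<in>glue \<beta>. prob (voronoi c (glue \<beta>)) > 0 \<and>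
      c = centroid P (voronoi c (glue \<beta>))"
    unfolding glue_def[of \<beta>] by auto
  ultimately show "is_CVT P (n 1 + n 2) (glue \<beta>)"
    using fing by (simp add: is_CVT_def)
  let ?m = "\<lambda>\<alpha> x. Min ((\<lambda>b. (x - b)\<^sup>2) ` \<alpha>)"
  have neg: "glue \<beta> \<noteq> {}" and subg: "glue \<beta> \<subseteq> {0..1}"
    using ne unit S_mem_unit by (auto simp: glue_def simp del: atLeastAtMost_iff)
  have meas: "?m \<alpha> \<in> borel_measurable borel" if "finite \<alpha>" for \<alpha> :: "real set"
    using that by (intro borel_measurable_Min) auto
  have int: "integrable P (?m (glue \<beta>))"
  proof (rule integrable_on_unit[OF meas[OF fing]])
    fix x :: real assume x: "x \<in> {0..1}"
    obtain b where b: "b \<in> glue \<beta>" "\<forall>c\<in>glue \<beta>. \<bar>x - b\<bar> \<le> \<bar>x - c\<bar>"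
      using ex_nearest[OF fing neg] by blast
    then have "?m (glue \<beta>) x = (x - b)\<^sup>2" using Min_sq_eq[OF fing] by blast
    moreover have "\<bar>x - b\<bar> \<le> 1" using x subg b(1) by (auto simp: abs_le_iff)
    ultimately show "\<bar>?m (glue \<beta>) x\<bar> \<le> 1" by (simp add: abs_square_le_1)
  qed
  have half: "(LINT x|P. ?m (glue \<beta>) (S r i x)) = r\<^sup>2 * distortion P (\<beta> i)" if ij: "{i, j} = {1, 2}" for i j
  proof -
    have i: "finite (\<beta> i)" "\<beta> i \<noteq> {}" using ij fin ne by (auto simp: doubleton_eq_iff)
    have "(LINT x|P. ?m (glue \<beta>) (S r i x)) = (LINT x|P. r\<^sup>2 * ?m (\<beta> i) x)"
    proof (rule integral_cong_AE)
      show "(\<lambda>x. ?m (glue \<beta>) (S r i x)) \<in> borel_measurable P"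
        using measurable_compose[OF measurable_S meas[OF fing]] by simp
      show "(\<lambda>x. r\<^sup>2 * ?m (\<beta> i) x) \<in> borel_measurable P"
        using meas[OF i(1)] by simp
      show "AE x in P. ?m (glue \<beta>) (S r i x) = r\<^sup>2 * ?m (\<beta> i) x"
        using AE_open_unit_interval
      proof eventually_elim
        case (elim x)
        obtain b where b: "b \<in> \<beta> i" "\<forall>c\<in>\<beta> i. \<bar>x - b\<bar> \<le> \<bar>x - c\<bar>"
          using ex_nearest[OF i] by blast
        then have "S r i x \<in> voronoi (S r i b) (glue \<beta>)"
          using voronoi_glue_same[OF sep fin ij b(1)] elim voronoi_iff[OF i(1) b(1)] by simp
        moreover have bg: "S r i b \<in> glue \<beta>" using b(1) glue_eq[OF ij] by blast
        ultimately have "?m (glue \<beta>) (S r i x) = (S r i x - S r i b)\<^sup>2"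
          using Min_sq_eq[OF fing bg] voronoi_iff[OF fing bg] by blast
        also have "\<dots> = r\<^sup>2 * (x - b)\<^sup>2"
          by (simp add: S_def power2_eq_square algebra_simps)
        finally show ?case using Min_sq_eq[OF i(1) b(1)] b(2) by simp
      qed
    qed
    then show ?thesis by (simp add: distortion_def)
  qed
  show "distortion P (glue \<beta>) = r\<^sup>2 / 2 * (distortion P (\<beta> 1) + distortion P (\<beta> 2))"
    using expectation_split[OF int] half[of 1 2] half[of 2 1]
    by (simp add: distortion_def insert_commute algebra_simps)
qed

definition glue_words :: "nat \<Rightarrow> (word \<Rightarrow> real set) \<Rightarrow> real set" where
  "glue_words m \<beta> = (\<Union>\<sigma>\<in>words m. S_word r \<sigma> ` \<beta> \<sigma>)"

lemma words_0 [simp]: "words 0 = {[]}"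
  by (auto simp: words_def)

lemma words_Suc: "words (Suc m) = Cons 1 ` words m \<union> Cons 2 ` words m"
  by (force simp: words_def length_Suc_conv)

lemma finite_words [simp]: "finite (words m)"
  by (induction m) (simp_all add: words_Suc)

lemma sum_words_Suc:
  fixes f :: "word \<Rightarrow> 'b :: comm_monoid_add"
  shows "(\<Sum>\<sigma>\<in>words (Suc m). f \<sigma>) = (\<Sum>\<sigma>\<in>words m. f (1 # \<sigma>)) + (\<Sum>\<sigma>\<in>words m. f (2 # \<sigma>))"
proof -
  have "Cons 1 ` words m \<inter> Cons 2 ` words m = {}" by auto
  then show ?thesis
    unfolding words_Suc by (simp add: sum.union_disjoint sum.reindex inj_on_def)
qed

lemma card_words: "card (words m) = 2 ^ m"
proof (induction m)
  case (Suc m)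
  then show ?case using sum_words_Suc[of "\<lambda>_. 1::nat" m] by simp
qed simp

lemma glue_words_0 [simp]: "glue_words 0 \<beta> = \<beta> []"
  by (simp add: glue_words_def)

lemma glue_words_Suc: "glue_words (Suc m) \<beta> = glue (\<lambda>i. glue_words m (\<lambda>\<sigma>. \<beta> (i # \<sigma>)))"
  by (simp add: glue_words_def glue_def words_Suc image_Un image_UN UN_Un image_image)

text \<open>
  The gap between the two halves has length \<open>1 - 2 * r\<close>. If the left half has a
  point within this distance of its right end, and the right half one within this distance of
  its left end, then no location is closer to a point across the gap than to the nearest of its
  own half. The scaled distance of \<open>b\<close> to the end is \<open>r * b\<close> or
  \<open>r * (1 - b)\<close>; both bounds survive gluing, which only brings the extreme points
  closer to the ends.
\<close>

definition glueable :: "real set \<Rightarrow> bool" where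
  "glueable \<alpha> \<longleftrightarrow> is_CVT P (card \<alpha>) \<alpha> \<and> \<alpha> \<subseteq> {0..1} \<and>
     (\<exists>b\<in>\<alpha>. r * b \<le> 1 - 2 * r) \<and> (\<exists>b\<in>\<alpha>. r * (1 - b) \<le> 1 - 2 * r)"

lemma separated_glueable:
  assumes "glueable (\<beta> 1)" "glueable (\<beta> 2)"
  shows "separated \<beta>"
  unfolding separated_def
proof (intro allI impI)
  fix i j :: nat and x b :: real
  assume ij: "{i, j} = {1, 2}" and x: "0 < x" "x < 1" and b: "b \<in> \<beta> j"
  have rx: "0 < r * x" "r * x < r" using x r_pos by auto
  have b01: "b \<in> {0..1}" using assms b ij by (auto simp: glueable_def doubleton_eq_iff)
  have rb: "0 \<le> r * b" "r * b \<le> r"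
    using b01 r_pos mult_left_mono[of b 1 r] by auto
  consider "i = 1" "j = 2" | "i = 2" "j = 1" using ij by (auto simp: doubleton_eq_iff)
  then show "\<exists>c\<in>\<beta> i. \<bar>S r i x - S r i c\<bar> < \<bar>S r i x - S r j b\<bar>"
  proof cases
    case 1
    obtain c where c: "c \<in> \<beta> 1" "r * (1 - c) \<le> 1 - 2 * r" using assms(1) by (auto simp: glueable_def)
    have "0 \<le> c" "c \<le> 1" using c(1) assms(1) by (auto simp: glueable_def)
    then have "0 \<le> r * c" "r * c \<le> r" using r_pos mult_left_mono[of c 1 r] by auto
    moreover have "r - r * c \<le> 1 - 2 * r" using c(2) by (simp add: right_diff_distrib)
    ultimately have "\<bar>r * x - r * c\<bar> < \<bar>r * x - (r * b + (1 - r))\<bar>"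
      using rx rb r_half by linarith
    then show ?thesis using c(1) 1 by (auto simp: S_simps)
  next
    case 2
    obtain c where c: "c \<in> \<beta> 2" "r * c \<le> 1 - 2 * r" using assms(2) by (auto simp: glueable_def)
    have "0 \<le> c" "c \<le> 1" using c(1) assms(2) by (auto simp: glueable_def)
    then have "0 \<le> r * c" "r * c \<le> r" using r_pos mult_left_mono[of c 1 r] by auto
    then have "\<bar>(r * x + (1 - r)) - (r * c + (1 - r))\<bar> < \<bar>(r * x + (1 - r)) - r * b\<bar>"
      using rx rb c(2) r_half by linarith
    then show ?thesis using c(1) 2 by (auto simp: S_simps)
  qed
qed

lemma
  assumes "is_CVT P (card (\<beta> 1)) (\<beta> 1)" "is_CVT P (card (\<beta> 2)) (\<beta> 2)"
    and "\<beta> 1 \<subseteq> {0..1}" "\<beta> 2 \<subseteq> {0..1}" "separated \<beta>"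
    and b: "b \<in> \<beta> 1" "r * (r * b) \<le> 1 - 2 * r" and c: "c \<in> \<beta> 2" "r * (r * (1 - c)) \<le> 1 - 2 * r"
  shows glueable_glue: "glueable (glue \<beta>)"
    and card_glue: "card (glue \<beta>) = card (\<beta> 1) + card (\<beta> 2)"
proof -
  have ne: "\<beta> 1 \<noteq> {}" "\<beta> 2 \<noteq> {}" using b c by auto
  have cvt: "is_CVT P (card (\<beta> 1) + card (\<beta> 2)) (glue \<beta>)"
    using is_CVT_glue[of "\<lambda>i. card (\<beta> i)" \<beta>] assms ne by simp
  then show card: "card (glue \<beta>) = card (\<beta> 1) + card (\<beta> 2)"
    by (simp add: is_CVT_def)
  have "glue \<beta> \<subseteq> {0..1}"
    using S_mem_unit assms(3,4) unfolding glue_def by blast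
  moreover have "S r 1 b \<in> glue \<beta>" "S r 2 c \<in> glue \<beta>" using b(1) c(1) by (auto simp: glue_def)
  moreover have "1 - S r 2 c = r * (1 - c)" by (simp add: S_def algebra_simps)
  ultimately show "glueable (glue \<beta>)"
    unfolding glueable_def card using cvt b(2) c(2) by (metis S_simps(1))
qed

lemma
  assumes "\<And>\<sigma>. \<sigma> \<in> words m \<Longrightarrow> glueable (\<beta> \<sigma>)"
  shows glueable_glue_words: "glueable (glue_words m \<beta>)"
    and card_glue_words: "card (glue_words m \<beta>) = (\<Sum>\<sigma>\<in>words m. card (\<beta> \<sigma>))"
    and distortion_glue_words:
      "distortion P (glue_words m \<beta>) = (r\<^sup>2 / 2) ^ m * (\<Sum>\<sigma>\<in>words m. distortion P (\<beta> \<sigma>))"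
proof -
  have "glueable (glue_words m \<beta>) \<and> card (glue_words m \<beta>) = (\<Sum>\<sigma>\<in>words m. card (\<beta> \<sigma>)) \<and>
      distortion P (glue_words m \<beta>) = (r\<^sup>2 / 2) ^ m * (\<Sum>\<sigma>\<in>words m. distortion P (\<beta> \<sigma>))"
    using assms
  proof (induction m arbitrary: \<beta>)
    case (Suc m)
    define \<gamma> where "\<gamma> i = glue_words m (\<lambda>\<sigma>. \<beta> (i # \<sigma>))" for i
    have IH: "glueable (\<gamma> i) \<and> card (\<gamma> i) = (\<Sum>\<sigma>\<in>words m. card (\<beta> (i # \<sigma>))) \<and>
        distortion P (\<gamma> i) = (r\<^sup>2 / 2) ^ m * (\<Sum>\<sigma>\<in>words m. distortion P (\<beta> (i # \<sigma>)))"
      if "i \<in> {1, 2}" for i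
      unfolding \<gamma>_def by (rule Suc.IH) (use Suc.prems that in \<open>auto simp: words_Suc\<close>)
    have g: "glueable (\<gamma> 1)" "glueable (\<gamma> 2)" using IH by auto
    have sep: "separated \<gamma>" using separated_glueable[OF g] .
    have shrink: "r * (r * y) \<le> 1 - 2 * r" if "r * y \<le> 1 - 2 * r" "0 \<le> y" for y
    proof -
      have "r * (r * y) \<le> 1 * (r * y)"
        using that(2) r_pos r_half by (intro mult_right_mono) auto
      then show ?thesis using that(1) by simp
    qed
    obtain b where b: "b \<in> \<gamma> 1" "r * b \<le> 1 - 2 * r" "b \<in> {0..1}"
      using g(1) by (auto simp: glueable_def)
    obtain c where c: "c \<in> \<gamma> 2" "r * (1 - c) \<le> 1 - 2 * r" "c \<in> {0..1}"
      using g(2) by (auto simp: glueable_def)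
    have cvt: "is_CVT P (card (\<gamma> 1)) (\<gamma> 1)" "is_CVT P (card (\<gamma> 2)) (\<gamma> 2)"
      and unit: "\<gamma> 1 \<subseteq> {0..1}" "\<gamma> 2 \<subseteq> {0..1}"
      using g by (auto simp: glueable_def)
    note gg = glueable_glue[OF cvt unit sep b(1) shrink c(1) shrink]
      card_glue[OF cvt unit sep b(1) shrink c(1) shrink]
    have "distortion P (glue \<gamma>) = r\<^sup>2 / 2 * (distortion P (\<gamma> 1) + distortion P (\<gamma> 2))"
      by (rule distortion_glue[OF cvt _ _ unit sep]) (use b c in auto)
    moreover have "glue_words (Suc m) \<beta> = glue \<gamma>"
      by (simp add: glue_words_Suc \<gamma>_def[abs_def])
    ultimately show ?case
      using gg b c IH[of 1] IH[of 2] by (simp add: sum_words_Suc algebra_simps)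
  qed simp
  then show "glueable (glue_words m \<beta>)" "card (glue_words m \<beta>) = (\<Sum>\<sigma>\<in>words m. card (\<beta> \<sigma>))"
    "distortion P (glue_words m \<beta>) = (r\<^sup>2 / 2) ^ m * (\<Sum>\<sigma>\<in>words m. distortion P (\<beta> \<sigma>))"
    by auto
qed

lemma is_CVT_half: "is_CVT P 1 {1/2}"
proof -
  have "voronoi (1/2) {1/2} = UNIV" by (simp add: voronoi_def)
  then show ?thesis by (simp add: is_CVT_def centroid_def set_lebesgue_integral_def mean)
qed

text \<open>
  These two codebooks fill the blocks that do not receive three points.
\<close>

definition pair :: "real set" where
  "pair = glue_words 1 (\<lambda>_. {1/2})"

definition quad :: "real set" where
  "quad = glue_words 2 (\<lambda>_. {1/2})"

text \<open>
  The one-point codebook \<open>{1/2}\<close> need not come close enough to the ends; its two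
  copies are separated by symmetry instead. Two copies of the resulting pair then meet the
  general condition.
\<close>

lemma
  assumes "r\<^sup>2 / 2 \<le> 1 - 2 * r"
  shows glueable_pair: "glueable pair" and card_pair: "card pair = 2"
    and glueable_quad: "glueable quad" and card_quad: "card quad = 4"
proof -
  let ?h = "\<lambda>_::nat. {1/2::real}"
  have sep: "separated ?h"
    unfolding separated_def
  proof (intro allI impI)
    fix i j :: nat and x b :: real
    assume ij: "{i, j} = {1, 2}" and x: "0 < x" "x < 1" and b: "b \<in> {1/2}"
    have rx: "0 < r * x" "r * x < r" using x r_pos by auto
    have b': "b = 1/2" using b by blast
    have "\<bar>S r 1 x - S r 1 b\<bar> < \<bar>S r 1 x - S r 2 b\<bar>" "\<bar>S r 2 x - S r 2 b\<bar> < \<bar>S r 2 x - S r 1 b\<bar>"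
      unfolding S_simps b' using rx r_half by linarith+
    then show "\<exists>c\<in>{1/2}. \<bar>S r i x - S r i c\<bar> < \<bar>S r i x - S r j b\<bar>"
      using ij unfolding b' by (auto simp: doubleton_eq_iff)
  qed
  have eq: "pair = glue ?h" by (simp add: pair_def glue_words_Suc)
  have rr: "r * (r * (1/2)) \<le> 1 - 2 * r" "r * (r * (1 - 1/2)) \<le> 1 - 2 * r"
    using assms by (simp_all add: power2_eq_square)
  have cvt: "is_CVT P (card (?h i)) (?h i)" for i using is_CVT_half by simp
  note pair = glueable_glue[OF cvt cvt _ _ sep, of "1/2" "1/2"] card_glue[OF cvt cvt _ _ sep, of "1/2" "1/2"]
  show gp: "glueable pair" and cp: "card pair = 2" using pair rr by (simp_all add: eq)
  have "quad = glue_words 1 (\<lambda>_. pair)"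
    by (simp add: quad_def pair_def glue_words_Suc numeral_2_eq_2)
  then show "glueable quad" "card quad = 4"
    using glueable_glue_words[of 1 "\<lambda>_. pair"] card_glue_words[of 1 "\<lambda>_. pair"] gp cp
    by (simp_all add: card_words)
qed

section \<open>Three clusters of cells\<close>

lemma cells_bounds:
  assumes "ordered ws" "x \<in> cells ws"
  shows "S_word r (hd ws) 0 \<le> x" "x \<le> S_word r (last ws) 1"
proof -
  have le: "S_word r \<tau> 0 \<le> S_word r \<tau> 1" for \<tau>
    using S_word_affine[of \<tau> 1] r_pos by simp
  obtain \<sigma> where \<sigma>: "\<sigma> \<in> set ws" "x \<in> J r \<sigma>" using assms(2) by (auto simp: cells_def)
  then have ne: "ws \<noteq> []" by auto
  have "hd ws = \<sigma> \<or> left_of (hd ws) \<sigma>"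
    using assms(1) \<sigma>(1) by (cases ws) (auto simp: ordered_def)
  then show "S_word r (hd ws) 0 \<le> x"
    using J_bounds(1)[OF \<sigma>(2)] le[of "hd ws"] left_of_endpoints[of "hd ws" \<sigma>] by force
  have "ordered (butlast ws @ [last ws])" "\<sigma> \<in> set (butlast ws @ [last ws])"
    using assms(1) \<sigma>(1) ne by simp_all
  then have "\<sigma> = last ws \<or> left_of \<sigma> (last ws)"
    unfolding ordered_def sorted_wrt_append by auto
  then show "x \<le> S_word r (last ws) 1"
    using J_bounds(2)[OF \<sigma>(2)] le[of "last ws"] left_of_endpoints[of \<sigma> "last ws"] by force
qed

lemma ordered_append:
  "ordered (vs @ ws) \<Longrightarrow> ordered vs" "ordered (vs @ ws) \<Longrightarrow> ordered ws"
  by (auto simp: ordered_def sorted_wrt_append)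

text \<open>
  Voronoi regions on the line are cut at the midpoints of neighbouring centroids. So three
  consecutive groups of cells are the regions of their centroids as soon as each midpoint lies
  in the gap between the last cell of one group and the first cell of the next.
\<close>

lemma
  assumes ord: "ordered (W1 @ W2 @ W3)" and ne: "W1 \<noteq> []" "W2 \<noteq> []" "W3 \<noteq> []"
    and total: "weight W1 + weight W2 + weight W3 = 1"
    and c: "c1 = moment W1 / weight W1" "c2 = moment W2 / weight W2" "c3 = moment W3 / weight W3"
    and lt: "c1 < c2" "c2 < c3"
    and mid1: "S_word r (last W1) 1 \<le> (c1 + c2) / 2" "(c1 + c2) / 2 \<le> S_word r (hd W2) 0"
    and mid2: "S_word r (last W2) 1 \<le> (c2 + c3) / 2" "(c2 + c3) / 2 \<le> S_word r (hd W3) 0"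
  shows three_cluster_CVT: "is_CVT P 3 {c1, c2, c3}"
    and three_cluster_distortion: "distortion P {c1, c2, c3} =
      (LINT x|P. x\<^sup>2) - (weight W1 * c1\<^sup>2 + weight W2 * c2\<^sup>2 + weight W3 * c3\<^sup>2)"
proof -
  let ?K = "{0, 1, 2 :: nat}"
  define c where "c = (!) [c1, c2, c3]"
  define U where "U k = cells ([W1, W2, W3] ! k)" for k
  have K: "finite ?K" "card ?K = 3" by simp_all
  have cK: "c ` ?K = {c1, c2, c3}" by (auto simp: c_def)
  have ords: "ordered W1" "ordered W2" "ordered W3"
    using ordered_append ord by blast+
  have inj: "inj_on c ?K" using lt by (auto simp: inj_on_def c_def)
  have borel: "U k \<in> sets borel" for k by (simp add: U_def)
  have sub: "U k \<subseteq> voronoi (c k) (c ` ?K)" if "k \<in> ?K" for k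
  proof
    fix x assume x: "x \<in> U k"
    then have "k = 0 \<and> x \<le> (c1 + c2) / 2 \<or> k = 1 \<and> (c1 + c2) / 2 \<le> x \<and> x \<le> (c2 + c3) / 2
        \<or> k = 2 \<and> (c2 + c3) / 2 \<le> x"
      using that cells_bounds[OF ords(1), of x] cells_bounds[OF ords(2), of x]
        cells_bounds[OF ords(3), of x] mid1 mid2 by (auto simp: U_def)
    moreover have "c k \<in> c ` ?K" using that by blast
    ultimately show "x \<in> voronoi (c k) (c ` ?K)"
      using lt by (subst voronoi_iff) (auto simp: cK c_def abs_if)
  qed
  have union: "(\<Union>k\<in>?K. U k) = cells (W1 @ W2 @ W3)"
    by (auto simp: U_def cells_def)
  have "prob (\<Union>k\<in>?K. U k) = 1"
    unfolding union using prob_cells[OF ord] total by (simp add: weight_def)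
  then have cover: "AE x in P. x \<in> (\<Union>k\<in>?K. U k)" by (rule AE_prob_1)
  have prob_U: "prob (U 0) = weight W1" "prob (U 1) = weight W2" "prob (U 2) = weight W3"
    using prob_cells ords by (simp_all add: U_def)
  have pos: "prob (U k) > 0" if "k \<in> ?K" for k
    using that prob_U weight_pos ne by auto
  have centre: "centroid P (U k) = c k" if "k \<in> ?K" for k
    using that prob_cells integral_cells ords assms(6-8)
    by (auto simp: U_def c_def centroid_def)
  note part = CVT_of_partition[OF K(1) inj borel sub cover pos centre]
    prob_voronoi_of_partition[OF K(1) inj borel sub cover pos centre]
  show cvt: "is_CVT P 3 {c1, c2, c3}"
    using part(1) by (simp only: cK K(2))
  have "prob (voronoi c1 {c1, c2, c3}) = weight W1" "prob (voronoi c2 {c1, c2, c3}) = weight W2"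
    "prob (voronoi c3 {c1, c2, c3}) = weight W3"
    using part(2)[of 0, unfolded cK] part(2)[of 1, unfolded cK] part(2)[of 2, unfolded cK] prob_U
    by (simp_all add: c_def)
  then show "distortion P {c1, c2, c3} =
      (LINT x|P. x\<^sup>2) - (weight W1 * c1\<^sup>2 + weight W2 * c2\<^sup>2 + weight W3 * c3\<^sup>2)"
    using distortion_of_CVT[OF cvt] lt by simp
qed

end

section \<open>The three-point sets of the theorem\<close>

text \<open>
  The second choice of clusters is the mirror image of the first. Keeping the words as data lets
  facts about all clusters be proved by inspecting lists.
\<close>

definition A_clusters :: "word list list list" where
  "A_clusters =
     [[[[1,1], [1,2,1], [1,2,2,1]], [[1,2,2,2], [2,1]], [[2,2]]],
      [[[1,1]], [[1,2], [2,1,1,1]], [[2,1,1,2], [2,1,2], [2,2]]]]"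

definition C_clusters :: "word list list list" where
  "C_clusters =
     [[[[1,1], [1,2,1,1], [1,2,1,2,1]], [[1,2,1,2,2], [1,2,2], [2,1,1]], [[2,1,2], [2,2]]],
      [[[1,1], [1,2,1]], [[1,2,2], [2,1,1], [2,1,2,1,1]], [[2,1,2,1,2], [2,1,2,2], [2,2]]]]"

definition cluster_centroids :: "real \<Rightarrow> real measure \<Rightarrow> word \<Rightarrow> word list list \<Rightarrow> real set" where
  "cluster_centroids r P \<sigma> Ws = (\<lambda>W. a r P (map ((@) \<sigma>) W)) ` set Ws"

lemma A_sets_eq: "A_sets r P \<sigma> = cluster_centroids r P \<sigma> ` set A_clusters"
  by (simp add: A_sets_def A_clusters_def cluster_centroids_def)

lemma C_sets_eq: "C_sets r P \<sigma> = cluster_centroids r P \<sigma> ` set C_clusters"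
  by (simp add: C_sets_def C_clusters_def cluster_centroids_def)

context cantor_measure
begin

lemma ordered_clusters:
  assumes "Ws \<in> set A_clusters \<union> set C_clusters"
  shows "ordered (concat Ws)" "W \<in> set Ws \<Longrightarrow> ordered W" "W \<in> set Ws \<Longrightarrow> W \<noteq> []"
  using assms by (auto simp: A_clusters_def C_clusters_def ordered_def)

lemma cluster_centroids_image:
  assumes "Ws \<in> set A_clusters \<union> set C_clusters" "set \<sigma> \<subseteq> {1,2}"
  shows "cluster_centroids r P \<sigma> Ws = S_word r \<sigma> ` cluster_centroids r P [] Ws"
proof -
  have "a r P (map ((@) \<sigma>) W) = S_word r \<sigma> (a r P (map ((@) []) W))" if "W \<in> set Ws" for W
    using a_map_append[of W \<sigma>] ordered_clusters[OF assms(1)] that assms(2) by (simp add: append_Nil[abs_def])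
  then show ?thesis by (force simp: cluster_centroids_def)
qed

lemma glueable_three_clusters:
  assumes Ws: "Ws = [W1, W2, W3]" and ord: "ordered (concat Ws)" and ne: "W1 \<noteq> []" "W2 \<noteq> []" "W3 \<noteq> []"
    and total: "weight W1 + weight W2 + weight W3 = 1"
    and c: "c1 = moment W1 / weight W1" "c2 = moment W2 / weight W2" "c3 = moment W3 / weight W3"
    and lt: "0 \<le> c1" "c1 < c2" "c2 < c3" "c3 \<le> 1"
    and mid1: "S_word r (last W1) 1 \<le> (c1 + c2) / 2" "(c1 + c2) / 2 \<le> S_word r (hd W2) 0"
    and mid2: "S_word r (last W2) 1 \<le> (c2 + c3) / 2" "(c2 + c3) / 2 \<le> S_word r (hd W3) 0"
    and ends: "r * c1 \<le> 1 - 2 * r" "r * (1 - c3) \<le> 1 - 2 * r"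
  shows "glueable (cluster_centroids r P [] Ws) \<and> card (cluster_centroids r P [] Ws) = 3 \<and>
    distortion P (cluster_centroids r P [] Ws) =
      (LINT x|P. x\<^sup>2) - (weight W1 * c1\<^sup>2 + weight W2 * c2\<^sup>2 + weight W3 * c3\<^sup>2)"
proof -
  have ord': "ordered (W1 @ W2 @ W3)" using ord Ws by simp
  have "ordered W1" "ordered W2" "ordered W3" using ordered_append ord' by blast+
  then have eq: "cluster_centroids r P [] Ws = {c1, c2, c3}"
    using a_eq_moment_div_weight c by (simp add: cluster_centroids_def Ws append_Nil[abs_def])
  have cvt: "is_CVT P 3 {c1, c2, c3}"
    by (rule three_cluster_CVT[OF ord' ne total c lt(2,3) mid1 mid2])
  have card: "card {c1, c2, c3} = 3" using cvt by (simp add: is_CVT_def)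
  have "glueable {c1, c2, c3}"
    unfolding glueable_def card using cvt lt ends by auto
  then show ?thesis
    unfolding eq using card three_cluster_distortion[OF ord' ne total c lt(2,3) mid1 mid2] by simp
qed

end

text \<open>
  The two polynomial conditions say that \<open>r\<close> lies between the two thresholds; the
  rational interval contains the thresholds, and its bounds are all that the remaining
  inequalities need.
\<close>

locale threshold_cantor_measure = cantor_measure +
  assumes r_bounds: "109/250 \<le> r" "r \<le> 449/1000"
    and above_r_minus: "69 * r ^ 4 + 14 * r ^ 2 - 76 * r + 28 \<le> 0"
    and below_r_star: "0 \<le> 44 - 160 * r + 196 * r ^ 2 - 178 * r ^ 3 + 198 * r ^ 4 - 199 * r ^ 5"
begin

text \<open>
  On so short an interval \<open>r\<^sup>2\<close> is linear in \<open>r\<close> up to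
  \<open>5/100000\<close>: the upper bound is the chord over \<open>[109/250, 449/1000]\<close>,
  the lower one the tangent at the midpoint \<open>177/400\<close>. Multiplied by powers of
  \<open>r\<close>, these two facts turn the polynomial inequalities below into linear ones.
\<close>

lemma power_recurrence_bounds:
  "r ^ (k + 2) \<le> 177/200 * r ^ (k + 1) - 48941/250000 * r ^ k"
  "177/200 * r ^ (k + 1) - 31329/160000 * r ^ k \<le> r ^ (k + 2)"
proof -
  have "0 \<le> (r - 109/250) * (449/1000 - r)" using r_bounds by simp
  also have "\<dots> = 177/200 * r - 48941/250000 - r\<^sup>2" by (simp add: power2_eq_square field_simps)
  finally have 1: "r\<^sup>2 \<le> 177/200 * r - 48941/250000" by simp
  have "0 \<le> (r - 177/400)\<^sup>2" by simp
  also have "\<dots> = r\<^sup>2 - (177/200 * r - 31329/160000)" by (simp add: power2_eq_square field_simps)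
  finally have 2: "177/200 * r - 31329/160000 \<le> r\<^sup>2" by simp
  show "r ^ (k + 2) \<le> 177/200 * r ^ (k + 1) - 48941/250000 * r ^ k"
    using mult_left_mono[OF 1, of "r ^ k"] r_pos by (simp add: power_add algebra_simps power2_eq_square)
  show "177/200 * r ^ (k + 1) - 31329/160000 * r ^ k \<le> r ^ (k + 2)"
    using mult_left_mono[OF 2, of "r ^ k"] r_pos by (simp add: power_add algebra_simps power2_eq_square)
qed

lemma power_bounds:
  "109/250 \<le> r" "r \<le> 449/1000"
  "r ^ 2 \<le> 177/200 * r - 48941/250000" "177/200 * r - 31329/160000 \<le> r ^ 2"
  "r ^ 3 \<le> 177/200 * r ^ 2 - 48941/250000 * r" "177/200 * r ^ 2 - 31329/160000 * r \<le> r ^ 3"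
  "r ^ 4 \<le> 177/200 * r ^ 3 - 48941/250000 * r ^ 2" "177/200 * r ^ 3 - 31329/160000 * r ^ 2 \<le> r ^ 4"
  "r ^ 5 \<le> 177/200 * r ^ 4 - 48941/250000 * r ^ 3" "177/200 * r ^ 4 - 31329/160000 * r ^ 3 \<le> r ^ 5"
  using r_bounds power_recurrence_bounds[of 0] power_recurrence_bounds[of 1]
    power_recurrence_bounds[of 2] power_recurrence_bounds[of 3]
  by (simp_all add: eval_nat_numeral)

text \<open>
  All four three-point sets have points within \<open>1/5\<close> of both ends.
\<close>

lemma end_gap:
  assumes "0 \<le> y" "y \<le> 1/5"
  shows "r * y \<le> 1 - 2 * r"
  using mult_mono[of r "449/1000" y "1/5"] r_bounds assms by simp

text \<open>
  The sums of mass times squared centroid, which by the distortion formula are to be compared.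
  One number serves both choices: reflection replaces each centroid \<open>c\<close> by \<open>1
  - c\<close>, which leaves the sum unchanged because the masses add up to \<open>1\<close> and
  the weighted mean of the centroids is \<open>1/2\<close>.
\<close>

definition quality_A :: real where
  "quality_A = 7/16 * (3/7 * r + r ^ 4 / 14)\<^sup>2 + 5/16 * (4/5 - 3/5 * r + 2/5 * r ^ 2 - r ^ 4 / 10)\<^sup>2
    + 1/4 * (1 - r ^ 2 / 2)\<^sup>2"

definition quality_C :: real where
  "quality_C = 11/32 * (3/11 * r + r ^ 2 / 11 + r ^ 3 / 11 + r ^ 5 / 22)\<^sup>2
    + 9/32 * (4/9 + r / 9 - r ^ 2 / 9 + r ^ 3 / 9 - r ^ 5 / 18)\<^sup>2
    + 3/8 * (1 - r / 3 - r ^ 3 / 6)\<^sup>2"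

text \<open>
  That the first midpoint lies to the left of the cell \<open>1222\<close> is the condition
  \<open>69 * r ^ 4 + 14 * r ^ 2 - 76 * r + 28 \<le> 0\<close>, which fails below the lower
  threshold. The other conditions have room to spare.
\<close>

lemma A_first_cluster_set:
  "glueable (cluster_centroids r P [] (A_clusters ! 0)) \<and> card (cluster_centroids r P [] (A_clusters ! 0)) = 3 \<and>
    distortion P (cluster_centroids r P [] (A_clusters ! 0)) = (LINT x|P. x\<^sup>2) - quality_A"
proof -
  let ?W1 = "[[1,1], [1,2,1], [1,2,2,1]] :: word list"
  let ?W2 = "[[1,2,2,2], [2,1]] :: word list"
  let ?W3 = "[[2,2]] :: word list"
  define c1 c2 c3 where "c1 = 3/7 * r + r ^ 4 / 14"
    and "c2 = 4/5 - 3/5 * r + 2/5 * r ^ 2 - r ^ 4 / 10"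
    and "c3 = 1 - r ^ 2 / 2"
  note c_def = this
  have w: "weight ?W1 = 7/16" "weight ?W2 = 5/16" "weight ?W3 = 1/4"
    by (simp_all add: weight_def)
  have Ws: "A_clusters ! 0 = [?W1, ?W2, ?W3]" by (simp add: A_clusters_def)
  have ord: "ordered (concat (A_clusters ! 0))"
    by (rule ordered_clusters) (simp add: A_clusters_def)
  have c: "c1 = moment ?W1 / weight ?W1" "c2 = moment ?W2 / weight ?W2" "c3 = moment ?W3 / weight ?W3"
    unfolding w c_def by (simp_all add: moment_def S_def field_simps eval_nat_numeral)
  have total: "weight ?W1 + weight ?W2 + weight ?W3 = 1" unfolding w by simp
  have lt: "0 \<le> c1" "c1 < c2" "c2 < c3" "c3 \<le> 1"
    using power_bounds unfolding c_def by linarith+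
  have endpoints: "S_word r (last ?W1) 1 = r - r ^ 3 + r ^ 4" "S_word r (hd ?W2) 0 = r - r ^ 4"
    "S_word r (last ?W2) 1 = 1 - r + r ^ 2" "S_word r (hd ?W3) 0 = 1 - r ^ 2"
    by (simp_all add: S_def field_simps eval_nat_numeral)
  have mid: "S_word r (last ?W1) 1 \<le> (c1 + c2) / 2" "(c1 + c2) / 2 \<le> S_word r (hd ?W2) 0"
    "S_word r (last ?W2) 1 \<le> (c2 + c3) / 2" "(c2 + c3) / 2 \<le> S_word r (hd ?W3) 0"
    unfolding endpoints c_def using power_bounds above_r_minus by argo+
  have c1: "c1 \<le> 1/5" and c3: "1 - c3 \<le> 1/5"
    using power_bounds unfolding c_def by linarith+
  have ends: "r * c1 \<le> 1 - 2 * r" "r * (1 - c3) \<le> 1 - 2 * r"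
    using end_gap[of c1] end_gap[of "1 - c3"] lt c1 c3 by simp_all
  have quality: "weight ?W1 * c1\<^sup>2 + weight ?W2 * c2\<^sup>2 + weight ?W3 * c3\<^sup>2 = quality_A"
    unfolding w c_def quality_A_def by (simp add: power2_eq_square field_simps)
  show ?thesis
    using glueable_three_clusters[OF Ws ord _ _ _ total c lt mid ends] unfolding quality by simp
qed

text \<open>
  In the mirror image the centroids are one minus the earlier ones, in reverse order, and the
  tight condition moves to the second midpoint.
\<close>

lemma A_second_cluster_set:
  "glueable (cluster_centroids r P [] (A_clusters ! 1)) \<and> card (cluster_centroids r P [] (A_clusters ! 1)) = 3 \<and>
    distortion P (cluster_centroids r P [] (A_clusters ! 1)) = (LINT x|P. x\<^sup>2) - quality_A"
proof -
  let ?W1 = "[[1,1]] :: word list"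
  let ?W2 = "[[1,2], [2,1,1,1]] :: word list"
  let ?W3 = "[[2,1,1,2], [2,1,2], [2,2]] :: word list"
  define c1 c2 c3 where "c1 = 1 - (1 - r ^ 2 / 2)"
    and "c2 = 1 - (4/5 - 3/5 * r + 2/5 * r ^ 2 - r ^ 4 / 10)"
    and "c3 = 1 - (3/7 * r + r ^ 4 / 14)"
  note c_def = this
  have w: "weight ?W1 = 1/4" "weight ?W2 = 5/16" "weight ?W3 = 7/16"
    by (simp_all add: weight_def)
  have Ws: "A_clusters ! 1 = [?W1, ?W2, ?W3]" by (simp add: A_clusters_def)
  have ord: "ordered (concat (A_clusters ! 1))"
    by (rule ordered_clusters) (simp add: A_clusters_def)
  have c: "c1 = moment ?W1 / weight ?W1" "c2 = moment ?W2 / weight ?W2" "c3 = moment ?W3 / weight ?W3"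
    unfolding w c_def by (simp_all add: moment_def S_def field_simps eval_nat_numeral)
  have total: "weight ?W1 + weight ?W2 + weight ?W3 = 1" unfolding w by simp
  have lt: "0 \<le> c1" "c1 < c2" "c2 < c3" "c3 \<le> 1"
    using power_bounds unfolding c_def by linarith+
  have endpoints: "S_word r (last ?W1) 1 = r ^ 2" "S_word r (hd ?W2) 0 = r - r ^ 2"
    "S_word r (last ?W2) 1 = 1 - r + r ^ 4" "S_word r (hd ?W3) 0 = 1 - r + r ^ 3 - r ^ 4"
    by (simp_all add: S_def field_simps eval_nat_numeral)
  have mid: "S_word r (last ?W1) 1 \<le> (c1 + c2) / 2" "(c1 + c2) / 2 \<le> S_word r (hd ?W2) 0"
    "S_word r (last ?W2) 1 \<le> (c2 + c3) / 2" "(c2 + c3) / 2 \<le> S_word r (hd ?W3) 0"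
    unfolding endpoints c_def using power_bounds above_r_minus by argo+
  have c1: "c1 \<le> 1/5" and c3: "1 - c3 \<le> 1/5"
    using power_bounds unfolding c_def by linarith+
  have ends: "r * c1 \<le> 1 - 2 * r" "r * (1 - c3) \<le> 1 - 2 * r"
    using end_gap[of c1] end_gap[of "1 - c3"] lt c1 c3 by simp_all
  have quality: "weight ?W1 * c1\<^sup>2 + weight ?W2 * c2\<^sup>2 + weight ?W3 * c3\<^sup>2 = quality_A"
    unfolding w c_def quality_A_def by (simp add: power2_eq_square field_simps)
  show ?thesis
    using glueable_three_clusters[OF Ws ord _ _ _ total c lt mid ends] unfolding quality by simp
qed

text \<open>
  Here the tight condition is that the first midpoint lies to the right of the cell
  \<open>12121\<close>; it fails above the upper threshold.
\<close>

lemma C_first_cluster_set: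
  "glueable (cluster_centroids r P [] (C_clusters ! 0)) \<and> card (cluster_centroids r P [] (C_clusters ! 0)) = 3 \<and>
    distortion P (cluster_centroids r P [] (C_clusters ! 0)) = (LINT x|P. x\<^sup>2) - quality_C"
proof -
  let ?W1 = "[[1,1], [1,2,1,1], [1,2,1,2,1]] :: word list"
  let ?W2 = "[[1,2,1,2,2], [1,2,2], [2,1,1]] :: word list"
  let ?W3 = "[[2,1,2], [2,2]] :: word list"
  define c1 c2 c3 where "c1 = 3/11 * r + r ^ 2 / 11 + r ^ 3 / 11 + r ^ 5 / 22"
    and "c2 = 4/9 + r / 9 - r ^ 2 / 9 + r ^ 3 / 9 - r ^ 5 / 18"
    and "c3 = 1 - r / 3 - r ^ 3 / 6"
  note c_def = this
  have w: "weight ?W1 = 11/32" "weight ?W2 = 9/32" "weight ?W3 = 3/8"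
    by (simp_all add: weight_def)
  have Ws: "C_clusters ! 0 = [?W1, ?W2, ?W3]" by (simp add: C_clusters_def)
  have ord: "ordered (concat (C_clusters ! 0))"
    by (rule ordered_clusters) (simp add: C_clusters_def)
  have c: "c1 = moment ?W1 / weight ?W1" "c2 = moment ?W2 / weight ?W2" "c3 = moment ?W3 / weight ?W3"
    unfolding w c_def by (simp_all add: moment_def S_def field_simps eval_nat_numeral)
  have total: "weight ?W1 + weight ?W2 + weight ?W3 = 1" unfolding w by simp
  have lt: "0 \<le> c1" "c1 < c2" "c2 < c3" "c3 \<le> 1"
    using power_bounds unfolding c_def by linarith+
  have endpoints: "S_word r (last ?W1) 1 = r - r ^ 2 + r ^ 3 - r ^ 4 + r ^ 5" "S_word r (hd ?W2) 0 = r - r ^ 2 + r ^ 3 - r ^ 5"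
    "S_word r (last ?W2) 1 = 1 - r + r ^ 3" "S_word r (hd ?W3) 0 = 1 - r + r ^ 2 - r ^ 3"
    by (simp_all add: S_def field_simps eval_nat_numeral)
  have mid: "S_word r (last ?W1) 1 \<le> (c1 + c2) / 2" "(c1 + c2) / 2 \<le> S_word r (hd ?W2) 0"
    "S_word r (last ?W2) 1 \<le> (c2 + c3) / 2" "(c2 + c3) / 2 \<le> S_word r (hd ?W3) 0"
    unfolding endpoints c_def using power_bounds below_r_star by argo+
  have c1: "c1 \<le> 1/5" and c3: "1 - c3 \<le> 1/5"
    using power_bounds unfolding c_def by linarith+
  have ends: "r * c1 \<le> 1 - 2 * r" "r * (1 - c3) \<le> 1 - 2 * r"
    using end_gap[of c1] end_gap[of "1 - c3"] lt c1 c3 by simp_all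
  have quality: "weight ?W1 * c1\<^sup>2 + weight ?W2 * c2\<^sup>2 + weight ?W3 * c3\<^sup>2 = quality_C"
    unfolding w c_def quality_C_def by (simp add: power2_eq_square field_simps)
  show ?thesis
    using glueable_three_clusters[OF Ws ord _ _ _ total c lt mid ends] unfolding quality by simp
qed

lemma C_second_cluster_set:
  "glueable (cluster_centroids r P [] (C_clusters ! 1)) \<and> card (cluster_centroids r P [] (C_clusters ! 1)) = 3 \<and>
    distortion P (cluster_centroids r P [] (C_clusters ! 1)) = (LINT x|P. x\<^sup>2) - quality_C"
proof -
  let ?W1 = "[[1,1], [1,2,1]] :: word list"
  let ?W2 = "[[1,2,2], [2,1,1], [2,1,2,1,1]] :: word list"
  let ?W3 = "[[2,1,2,1,2], [2,1,2,2], [2,2]] :: word list"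
  define c1 c2 c3 where "c1 = 1 - (1 - r / 3 - r ^ 3 / 6)"
    and "c2 = 1 - (4/9 + r / 9 - r ^ 2 / 9 + r ^ 3 / 9 - r ^ 5 / 18)"
    and "c3 = 1 - (3/11 * r + r ^ 2 / 11 + r ^ 3 / 11 + r ^ 5 / 22)"
  note c_def = this
  have w: "weight ?W1 = 3/8" "weight ?W2 = 9/32" "weight ?W3 = 11/32"
    by (simp_all add: weight_def)
  have Ws: "C_clusters ! 1 = [?W1, ?W2, ?W3]" by (simp add: C_clusters_def)
  have ord: "ordered (concat (C_clusters ! 1))"
    by (rule ordered_clusters) (simp add: C_clusters_def)
  have c: "c1 = moment ?W1 / weight ?W1" "c2 = moment ?W2 / weight ?W2" "c3 = moment ?W3 / weight ?W3"
    unfolding w c_def by (simp_all add: moment_def S_def field_simps eval_nat_numeral)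
  have total: "weight ?W1 + weight ?W2 + weight ?W3 = 1" unfolding w by simp
  have lt: "0 \<le> c1" "c1 < c2" "c2 < c3" "c3 \<le> 1"
    using power_bounds unfolding c_def by linarith+
  have endpoints: "S_word r (last ?W1) 1 = r - r ^ 2 + r ^ 3" "S_word r (hd ?W2) 0 = r - r ^ 3"
    "S_word r (last ?W2) 1 = 1 - r + r ^ 2 - r ^ 3 + r ^ 5" "S_word r (hd ?W3) 0 = 1 - r + r ^ 2 - r ^ 3 + r ^ 4 - r ^ 5"
    by (simp_all add: S_def field_simps eval_nat_numeral)
  have mid: "S_word r (last ?W1) 1 \<le> (c1 + c2) / 2" "(c1 + c2) / 2 \<le> S_word r (hd ?W2) 0"
    "S_word r (last ?W2) 1 \<le> (c2 + c3) / 2" "(c2 + c3) / 2 \<le> S_word r (hd ?W3) 0"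
    unfolding endpoints c_def using power_bounds below_r_star by argo+
  have c1: "c1 \<le> 1/5" and c3: "1 - c3 \<le> 1/5"
    using power_bounds unfolding c_def by linarith+
  have ends: "r * c1 \<le> 1 - 2 * r" "r * (1 - c3) \<le> 1 - 2 * r"
    using end_gap[of c1] end_gap[of "1 - c3"] lt c1 c3 by simp_all
  have quality: "weight ?W1 * c1\<^sup>2 + weight ?W2 * c2\<^sup>2 + weight ?W3 * c3\<^sup>2 = quality_C"
    unfolding w c_def quality_C_def by (simp add: power2_eq_square field_simps)
  show ?thesis
    using glueable_three_clusters[OF Ws ord _ _ _ total c lt mid ends] unfolding quality by simp
qed

text \<open>
  All centroids equal \<open>1/2\<close> at \<open>r = 1\<close>, and their weighted mean is
  \<open>1/2\<close> for every \<open>r\<close>. So each of the two sums is \<open>1/4\<close>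
  plus a weighted sum of squares that are divisible by \<open>(1 - r)\<^sup>2\<close>, which
  explains this factor of the difference. In the other factor \<open>300 * r ^ 2\<close> and
  \<open>139 * r ^ 6\<close> are absorbed by \<open>4312 * r\<close> and \<open>72 * r ^
  5\<close>; what is left increases with \<open>r\<close> and is already positive at
  \<open>109/250\<close>.
\<close>

lemma quality_less: "quality_A < quality_C"
proof -
  let ?g = "- 2156 + 4312 * r - 300 * r ^ 2 + 2060 * r ^ 3 + 5470 * r ^ 4 + 72 * r ^ 5
    - 139 * r ^ 6 + 350 * r ^ 7 + 175 * r ^ 8"
  have "110880 * (quality_C - quality_A) = (1 - r)\<^sup>2 * ?g"
    unfolding quality_A_def quality_C_def by (simp add: eval_nat_numeral field_simps)
  moreover have "0 < ?g"
  proof -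
    have "r ^ 2 \<le> 449/1000 * r" using r_bounds r_pos by (simp add: power2_eq_square)
    moreover have "1295029/15625000 \<le> r ^ 3" "141158161/3906250000 \<le> r ^ 4"
      using r_bounds power_mono[of "109/250" r 3] power_mono[of "109/250" r 4]
      by (simp_all add: power_divide)
    moreover have "r ^ 6 \<le> 449/1000 * r ^ 5"
      using r_bounds r_pos mult_right_mono[of r "449/1000" "r ^ 5"] by (simp add: eval_nat_numeral)
    moreover have "0 \<le> r ^ 5" "0 \<le> r ^ 7" "0 \<le> r ^ 8" using r_pos by simp_all
    ultimately show ?thesis using r_bounds by linarith
  qed
  moreover have "0 < (1 - r)\<^sup>2" using r_half by simp
  ultimately have "0 < 110880 * (quality_C - quality_A)" by simp
  then show ?thesis by simp
qed

lemma half_pair_bound: "r\<^sup>2 / 2 \<le> 1 - 2 * r"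
  using power_bounds by linarith

section \<open>Codebooks\<close>

text \<open>
  Both kinds of codebook put three points into the blocks of a set \<open>K\<close> and a fixed
  two- or four-point set into the others. The distortion then depends on the choice of the
  three-point sets only through their common distortion \<open>D\<close>.
\<close>

lemma block_codebook:
  assumes n: "2 ^ (m + 1) < n" "n < 2 ^ (m + 2)" and ell: "ell n = m + 1"
    and I: "admissible n I"
    and K_def: "K = (if n \<le> 3 * 2 ^ m then I else words m - I)"
    and rest_def: "rest = (if n \<le> 3 * 2 ^ m then pair else quad)"
    and B: "\<forall>\<sigma>\<in>words m. \<exists>Y. B \<sigma> = S_word r \<sigma> ` Y \<and> glueable Y \<and> card Y = 3 \<and> distortion P Y = D"
  shows "K \<noteq> {} \<and> finite K" and "is_CVT P n (codebook r B n I)"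
    and "distortion P (codebook r B n I) =
      (r\<^sup>2 / 2) ^ m * (real (card K) * D + real (card (words m - K)) * distortion P rest)"
proof -
  have "\<exists>Y. \<forall>\<sigma>\<in>words m. B \<sigma> = S_word r \<sigma> ` Y \<sigma> \<and> glueable (Y \<sigma>) \<and> card (Y \<sigma>) = 3 \<and> distortion P (Y \<sigma>) = D"
    using B by (rule bchoice)
  then obtain Y where Y: "\<And>\<sigma>. \<sigma> \<in> words m \<Longrightarrow> B \<sigma> = S_word r \<sigma> ` Y \<sigma>"
    "\<And>\<sigma>. \<sigma> \<in> words m \<Longrightarrow> glueable (Y \<sigma>) \<and> card (Y \<sigma>) = 3 \<and> distortion P (Y \<sigma>) = D"
    by blast
  define \<beta> where "\<beta> \<sigma> = (if \<sigma> \<in> K then Y \<sigma> else rest)" for \<sigma>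
  have sub: "I \<subseteq> words m" and cardI: "card I = (if n \<le> 3 * 2 ^ m then n - 2 ^ (m + 1) else n - 3 * 2 ^ m)"
    using I by (auto simp: admissible_def Let_def ell)
  have K: "K \<subseteq> words m" using sub by (auto simp: K_def)
  then have finK: "finite K" by (rule finite_subset) simp
  have cardwI: "card (words m - I) = 2 ^ m - card I"
    using sub by (simp add: card_Diff_subset finite_subset[OF sub] card_words)
  have cardwK: "card (words m - K) = 2 ^ m - card K"
    using K by (simp add: card_Diff_subset finK card_words)
  have cardK: "card K = (if n \<le> 3 * 2 ^ m then n - 2 ^ (m + 1) else 2 ^ m - (n - 3 * 2 ^ m))"
    using cardI cardwI by (simp add: K_def)
  have "card K > 0" using cardK n by auto
  then show "K \<noteq> {} \<and> finite K" using finK by auto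
  have glueable: "glueable (\<beta> \<sigma>)" if "\<sigma> \<in> words m" for \<sigma>
    using Y that glueable_pair[OF half_pair_bound] glueable_quad[OF half_pair_bound] by (simp add: \<beta>_def rest_def)
  have split: "(\<Sum>\<sigma>\<in>words m. f (\<beta> \<sigma>)) = (\<Sum>\<sigma>\<in>K. f (Y \<sigma>)) + (\<Sum>\<sigma>\<in>words m - K. f rest)"
    for f :: "real set \<Rightarrow> 'b :: comm_monoid_add"
  proof -
    have "(\<Sum>\<sigma>\<in>words m. f (\<beta> \<sigma>)) = (\<Sum>\<sigma>\<in>words m - K. f (\<beta> \<sigma>)) + (\<Sum>\<sigma>\<in>K. f (\<beta> \<sigma>))"
      by (rule sum.subset_diff[OF K]) simp
    then show ?thesis by (simp add: \<beta>_def add.commute)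
  qed
  have rest: "S_word r \<sigma> ` rest = (if n \<le> 3 * 2 ^ m
      then {S_word r (\<sigma> @ [1]) (1/2), S_word r (\<sigma> @ [2]) (1/2)}
      else {S_word r (\<sigma> @ \<tau>) (1/2) | \<tau>. \<tau> \<in> words 2})" for \<sigma>
    by (auto simp: rest_def pair_def quad_def glue_words_def words_Suc S_word_append)
  have cowords: "words m - K = (if n \<le> 3 * 2 ^ m then words m - I else I)"
    using sub by (auto simp: K_def)
  have "codebook r B n I = (\<Union>\<sigma>\<in>K. B \<sigma>) \<union> (\<Union>\<sigma>\<in>words m - K. S_word r \<sigma> ` rest)"
    unfolding cowords by (auto simp: codebook_def ell rest K_def)
  also have "(\<Union>\<sigma>\<in>K. B \<sigma>) = (\<Union>\<sigma>\<in>K. S_word r \<sigma> ` \<beta> \<sigma>)"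
    by (rule SUP_cong) (use Y(1) K in \<open>auto simp: \<beta>_def\<close>)
  also have "(\<Union>\<sigma>\<in>words m - K. S_word r \<sigma> ` rest) = (\<Union>\<sigma>\<in>words m - K. S_word r \<sigma> ` \<beta> \<sigma>)"
    by (rule SUP_cong) (simp_all add: \<beta>_def)
  also have "(\<Union>\<sigma>\<in>K. S_word r \<sigma> ` \<beta> \<sigma>) \<union> (\<Union>\<sigma>\<in>words m - K. S_word r \<sigma> ` \<beta> \<sigma>) = glue_words m \<beta>"
    using K by (auto simp: glue_words_def)
  finally have eq: "codebook r B n I = glue_words m \<beta>" .
  have "card (codebook r B n I) = 3 * card K + card rest * card (words m - K)"
    unfolding eq using card_glue_words[OF glueable] split[of card] Y(2) K by (simp add: subset_iff)
  also have "\<dots> = n"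
    unfolding cardwK using n cardK card_pair[OF half_pair_bound] card_quad[OF half_pair_bound]
    by (auto simp: rest_def)
  finally show "is_CVT P n (codebook r B n I)"
    using glueable_glue_words[of m \<beta>, OF glueable] by (simp add: eq glueable_def)
  show "distortion P (codebook r B n I) =
      (r\<^sup>2 / 2) ^ m * (real (card K) * D + real (card (words m - K)) * distortion P rest)"
    unfolding eq using distortion_glue_words[OF glueable] split[of "distortion P"] Y(2) K
    by (simp add: subset_iff)
qed

end

text \<open>
  The difference quotient is at most \<open>0\<close>. So the polynomial stays at most
  \<open>0\<close> from its root up to \<open>1/2\<close>, and a value of known sign locates the
  root.
\<close>

lemma r_minus_polynomial_antimono:
  fixes x y :: real
  assumes "0 \<le> x" "x \<le> y" "y \<le> 1/2"
  shows "69 * y ^ 4 + 14 * y ^ 2 - 76 * y + 28 \<le> 69 * x ^ 4 + 14 * x ^ 2 - 76 * x + 28"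
proof -
  have sq: "x\<^sup>2 \<le> 1/4" "y\<^sup>2 \<le> 1/4" "0 \<le> x\<^sup>2" "0 \<le> y\<^sup>2"
    using assms power_mono[of x "1/2" 2] power_mono[of y "1/2" 2] by (simp_all add: power_divide)
  have "(x + y) * (x\<^sup>2 + y\<^sup>2) \<le> 1 * (1/2)"
    using assms sq by (intro mult_mono) auto
  then have "69 * ((x + y) * (x\<^sup>2 + y\<^sup>2)) + 14 * x + 14 * y - 76 \<le> 0"
    using assms by linarith
  then have "(y - x) * (69 * ((x + y) * (x\<^sup>2 + y\<^sup>2)) + 14 * x + 14 * y - 76) \<le> 0"
    using assms(2) by (simp add: mult_nonneg_nonpos)
  moreover have "(y - x) * (69 * ((x + y) * (x\<^sup>2 + y\<^sup>2)) + 14 * x + 14 * y - 76) =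
      (69 * y ^ 4 + 14 * y ^ 2 - 76 * y + 28) - (69 * x ^ 4 + 14 * x ^ 2 - 76 * x + 28)"
    by (simp add: eval_nat_numeral algebra_simps)
  ultimately show ?thesis by linarith
qed

lemma r_star_polynomial_antimono:
  fixes x y :: real
  assumes "43/100 \<le> x" "x \<le> y" "y \<le> 45/100"
  shows "44 - 160 * y + 196 * y ^ 2 - 178 * y ^ 3 + 198 * y ^ 4 - 199 * y ^ 5
    \<le> 44 - 160 * x + 196 * x ^ 2 - 178 * x ^ 3 + 198 * x ^ 4 - 199 * x ^ 5"
proof -
  define p q where "p = (x + y) * (x * x + y * y)"
    and "q = x ^ 4 + x ^ 3 * y + x\<^sup>2 * y\<^sup>2 + x * y ^ 3 + y ^ 4"
  let ?d = "- 160 + 196 * x + 196 * y - 178 * (x * x) - 178 * (x * y) - 178 * (y * y) + 198 * p - 199 * q"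
  have nonneg: "0 \<le> x" "0 \<le> y" using assms by auto
  have lower: "43/100 * (43/100) \<le> x * x" "43/100 * (43/100) \<le> x * y" "43/100 * (43/100) \<le> y * y"
    using assms by (intro mult_mono; simp)+
  have "x * x \<le> 45/100 * (45/100)" "y * y \<le> 45/100 * (45/100)"
    using assms by (intro mult_mono; simp)+
  then have "p \<le> 9/10 * (81/200)"
    unfolding p_def using assms nonneg by (intro mult_mono) auto
  moreover have "0 \<le> q" unfolding q_def using nonneg by simp
  ultimately have "?d \<le> 0"
    using lower assms by linarith
  then have "(y - x) * ?d \<le> 0"
    using assms(2) by (simp add: mult_nonneg_nonpos)
  moreover have "(y - x) * ?d = (44 - 160 * y + 196 * y ^ 2 - 178 * y ^ 3 + 198 * y ^ 4 - 199 * y ^ 5)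
      - (44 - 160 * x + 196 * x ^ 2 - 178 * x ^ 3 + 198 * x ^ 4 - 199 * x ^ 5)"
    unfolding p_def q_def by (simp add: eval_nat_numeral algebra_simps)
  ultimately show ?thesis by linarith
qed

lemma ell_of_non_power_of_two:
  fixes n :: nat
  assumes "n \<ge> 2" "\<not> (\<exists>m::nat. m > 0 \<and> n = 2 ^ m)"
  obtains m where "2 ^ (m + 1) < n" "n < 2 ^ (m + 2)" "ell n = m + 1"
proof -
  obtain l where l: "2 ^ l \<le> n" "n < 2 ^ (l + 1)"
    using ex_power_ivl1[of 2 n] assms(1) by auto
  have "l \<noteq> 0" using l(2) assms(1) by (intro notI) simp
  then obtain m where m: "l = m + 1" by (cases l) auto
  have less: "2 ^ l < n" using l(1) assms(2) \<open>l \<noteq> 0\<close> by (metis gr0I le_neq_implies_less)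
  have "ell n = l"
    unfolding ell_def
  proof (rule the_equality)
    fix k assume k: "2 ^ k < n \<and> n < 2 ^ (k + 1)"
    then have "(2::nat) ^ k < 2 ^ (l + 1)" "(2::nat) ^ l < 2 ^ (k + 1)" using l less by linarith+
    then have "k < l + 1" "l < k + 1" by (simp_all only: power_strict_increasing_iff[of 2] one_less_numeral_iff semiring_norm)
    then show "k = l" by simp
  qed (use less l in blast)
  then show ?thesis using that[of m] less l(2) m by simp
qed

theorem proposition5p1:
  fixes r r_minus r_star :: real
    and P :: "real measure"
    and n :: nat
    and I :: "word set"
    and A C :: "word \<Rightarrow> real set"
  assumes r_minus: "0.43 < r_minus" "r_minus < 0.44"
      "69 * r_minus ^ 4 + 14 * r_minus ^ 2 - 76 * r_minus + 28 = 0"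
    and r_star: "0.44 < r_star" "r_star < 0.45"
      "44 - 160 * r_star + 196 * r_star ^ 2 - 178 * r_star ^ 3
         + 198 * r_star ^ 4 - 199 * r_star ^ 5 = 0"
    and r: "r_minus \<le> r" "r \<le> r_star"
    and P: "self_similar_measure r P"
    and n: "n \<ge> 2" "\<not> (\<exists>m::nat. m > 0 \<and> n = 2 ^ m)"
    and I: "admissible n I"
    and A: "\<And>k \<sigma>. \<sigma> \<in> words k \<Longrightarrow> A \<sigma> \<in> A_sets r P \<sigma>"
    and C: "\<And>k \<sigma>. \<sigma> \<in> words k \<Longrightarrow> C \<sigma> \<in> C_sets r P \<sigma>"
  shows "is_CVT P n (codebook r C n I) \<and> is_CVT P n (codebook r A n I) \<and>
         distortion P (codebook r C n I) < distortion P (codebook r A n I)"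
proof -
  have "0.436 \<le> r_minus"
  proof (rule ccontr)
    assume "\<not> ?thesis"
    then have "69 * 0.436 ^ 4 + 14 * 0.436 ^ 2 - 76 * 0.436 + 28 \<le> (0::real)"
      using r_minus_polynomial_antimono[of r_minus "0.436"] r_minus by simp
    then show False by (simp add: power_numeral_reduce)
  qed
  moreover have "r_star \<le> 0.449"
  proof (rule ccontr)
    assume "\<not> ?thesis"
    then have "(0::real) \<le> 44 - 160 * 0.449 + 196 * 0.449 ^ 2 - 178 * 0.449 ^ 3 + 198 * 0.449 ^ 4 - 199 * 0.449 ^ 5"
      using r_star_polynomial_antimono[of "0.449" r_star] r_star by simp
    then show False by (simp add: power_numeral_reduce)
  qed
  moreover have "69 * r ^ 4 + 14 * r ^ 2 - 76 * r + 28 \<le> 0"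
    using r_minus_polynomial_antimono[of r_minus r] r_minus r r_star(2) by simp
  moreover have "0 \<le> 44 - 160 * r + 196 * r ^ 2 - 178 * r ^ 3 + 198 * r ^ 4 - 199 * r ^ 5"
    using r_star_polynomial_antimono[of r r_star] r_minus(1) r r_star by simp
  ultimately interpret threshold_cantor_measure r P
    using r r_minus(1) r_star(2) P by unfold_locales simp_all
  obtain m where m: "2 ^ (m + 1) < n" "n < 2 ^ (m + 2)" "ell n = m + 1"
    using ell_of_non_power_of_two[OF n] .
  define K where "K = (if n \<le> 3 * 2 ^ m then I else words m - I)"
  define rest where "rest = (if n \<le> 3 * 2 ^ m then pair else quad)"
  let ?E = "LINT x|P. x\<^sup>2"
  have shape_A: "\<forall>\<sigma>\<in>words m. \<exists>Y. A \<sigma> = S_word r \<sigma> ` Y \<and> glueable Y \<and> card Y = 3 \<and>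
      distortion P Y = ?E - quality_A"
  proof
    fix \<sigma> assume \<sigma>: "\<sigma> \<in> words m"
    obtain Ws where Ws: "Ws \<in> set A_clusters" "A \<sigma> = cluster_centroids r P \<sigma> Ws"
      using A[OF \<sigma>] by (auto simp: A_sets_eq)
    then have "Ws = A_clusters ! 0 \<or> Ws = A_clusters ! 1" by (auto simp: A_clusters_def)
    then show "\<exists>Y. A \<sigma> = S_word r \<sigma> ` Y \<and> glueable Y \<and> card Y = 3 \<and> distortion P Y = ?E - quality_A"
      using A_first_cluster_set A_second_cluster_set Ws \<sigma> cluster_centroids_image[of Ws \<sigma>] by (auto simp: words_def)
  qed
  have shape_C: "\<forall>\<sigma>\<in>words m. \<exists>Y. C \<sigma> = S_word r \<sigma> ` Y \<and> glueable Y \<and> card Y = 3 \<and>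
      distortion P Y = ?E - quality_C"
  proof
    fix \<sigma> assume \<sigma>: "\<sigma> \<in> words m"
    obtain Ws where Ws: "Ws \<in> set C_clusters" "C \<sigma> = cluster_centroids r P \<sigma> Ws"
      using C[OF \<sigma>] by (auto simp: C_sets_eq)
    then have "Ws = C_clusters ! 0 \<or> Ws = C_clusters ! 1" by (auto simp: C_clusters_def)
    then show "\<exists>Y. C \<sigma> = S_word r \<sigma> ` Y \<and> glueable Y \<and> card Y = 3 \<and> distortion P Y = ?E - quality_C"
      using C_first_cluster_set C_second_cluster_set Ws \<sigma> cluster_centroids_image[of Ws \<sigma>] by (auto simp: words_def)
  qed
  note block_A = block_codebook[OF m I K_def rest_def shape_A]
  note block_C = block_codebook[OF m I K_def rest_def shape_C]
  have "real (card K) > 0" using block_A(1) by (simp add: card_gt_0_iff)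
  moreover have "0 < (r\<^sup>2 / 2) ^ m" using r_pos by simp
  ultimately have "distortion P (codebook r C n I) < distortion P (codebook r A n I)"
    using quality_less by (subst block_A(3), subst block_C(3)) simp
  then show ?thesis using block_A(2) block_C(2) by blast
qed

end
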